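(* Let $b>0$ be a constant and let $M_1(b)$ be a non-planar regular rotational surface with zero mean curvature in $\mathbb{E}^4_2$ parametrized by $r_1(s,t)=(w(s)\sinh t,\ y(s)\cosh(bt),\ y(s)\sinh(bt),\ w(s)\cosh t)$, with profile curve $\alpha(s)=(0,y(s),0,w(s))$. Then: (i) If $b=1$ and the components of the profile curve $\alpha$ satisfy $$(w(s)+y(s))^2+\lambda_0(w(s)-y(s))^2=\mu_0$$ for some constants $\lambda_0\neq0$ and $\mu_0$, then the surface $M_1(1)$ has pointwise 1-type Gauss map of the second kind. (ii) If $b\neq1$ and $M_1(b)$ is timelike, then $M_1(b)$ has pointwise 1-type Gauss map of the second kind if and only if the profile curve $\alpha$ is given by $y(s)=b_0|w(s)|^{b}$ or $y(s)=b_0|w(s)|^{-b}$ for some constant $b_0\neq0$.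
   Context: $\mathbb{E}^4_2$ is $\mathbb{R}^4$ with the metric $g=dx_1^2+dx_2^2-dx_3^2-dx_4^2$, and $\langle\cdot,\cdot\rangle$ is the associated indefinite inner product. The rotational surface $M_1(b)$: $y,w$ are smooth functions on an open interval $I\subset\mathbb{R}$, $s\in I$, $t\in\mathbb{R}$. Regularity means $y'(s)^2-w'(s)^2\neq0$ and $w(s)^2-b^2y(s)^2\neq0$ for all $s\in I$, so that the induced metric is nondegenerate. Put $\varepsilon=\mathrm{sgn}(y'^2-w'^2)$ and $\varepsilon^*=\mathrm{sgn}(w^2-b^2y^2)$; then the unit vectors in the directions $\partial/\partial t$ and $\partial/\partial s$ (which are orthogonal) have squared length $\varepsilon^*$ and $\varepsilon$, respectively. $M_1(b)$ is timelike if the induced metric is Lorentzian, i.e. $\varepsilon\varepsilon^*=-1$. Non-planar means not an open part of a 2-plane. Let $\{e_1,e_2,e_3,e_4\}$ be an oriented local orthonormal frame with $e_1,e_2$ tangent and $e_3,e_4$ normal to the surface $M$, $\varepsilon_A=\langle e_A,e_A\rangle=\pm1$. The mean curvature vector is $H=\frac12\sum_{i=1}^2\varepsilon_i h(e_i,e_i)$, where $h$ is the second fundamental form; zero mean curvature means $H\equiv0$. The Gauss map is $\nu=e_3\wedge e_4$, viewed as a map $M\to\Lambda^2\mathbb{E}^4_2\cong\mathbb{E}^6_s$ (pseudo-Euclidean space for the inner product induced on $\Lambda^2$ by determinants). The Laplacian on $M$ is $\Delta=\sum_{i=1}^2\varepsilon_i(\nabla_{e_i}e_i-e_ie_i)$,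 where $\nabla$ is the Levi-Civita connection of $M$, applied componentwise to vector-valued maps. $M$ has pointwise 1-type Gauss map if $\Delta\nu=f(\nu+C)$ for some smooth function $f$ on $M$ and some constant vector $C\in\Lambda^2\mathbb{E}^4_2$; it is of the first kind if $C=0$, and of the second kind otherwise. *)

theory Defs
  imports "HOL-Analysis.Analysis"
begin

text \<open>Smoothness on an open set; every notion below is used on open sets only.\<close>

primrec Ck_on :: "nat \<Rightarrow> ('a::real_normed_vector \<Rightarrow> 'b::real_normed_vector) \<Rightarrow> 'a set \<Rightarrow> bool" where
  "Ck_on 0 f S \<longleftrightarrow> continuous_on S f"
| "Ck_on (Suc k) f S \<longleftrightarrow>
     (\<forall>x\<in>S. f differentiable (at x)) \<and>
     (\<forall>v. Ck_on k (\<lambda>x. frechet_derivative f (at x) v) S)"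

definition smooth_on :: "'a::real_normed_vector set \<Rightarrow> ('a \<Rightarrow> 'b::real_normed_vector) \<Rightarrow> bool" where
  "smooth_on S f \<longleftrightarrow> (\<forall>k. Ck_on k f S)"

definition E42_inner :: "real^4 \<Rightarrow> real^4 \<Rightarrow> real" where
  "E42_inner x y = x$1 * y$1 + x$2 * y$2 - x$3 * y$3 - x$4 * y$4"

text \<open>
  A surface is a parametrization \<open>r\<close> of type \<open>real^2 \<Rightarrow> real^4\<close> on an open set of parameters.
  Tangent vector fields are given by their components with respect to the coordinate fields,
  i.e. as maps \<open>X\<close> of type \<open>real^2 \<Rightarrow> real^2\<close>; \<open>dir_deriv X \<phi>\<close> is \<open>X\<close> applied to \<open>\<phi>\<close>, and
  \<open>push r X\<close> is the corresponding field of vectors tangent to the surface in the ambient space.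
\<close>

definition dir_deriv :: "(real^2 \<Rightarrow> real^2) \<Rightarrow> (real^2 \<Rightarrow> 'b::real_normed_vector) \<Rightarrow> real^2 \<Rightarrow> 'b" where
  "dir_deriv X \<phi> p = frechet_derivative \<phi> (at p) (X p)"

definition push :: "(real^2 \<Rightarrow> real^4) \<Rightarrow> (real^2 \<Rightarrow> real^2) \<Rightarrow> real^2 \<Rightarrow> real^4" where
  "push r X p = frechet_derivative r (at p) (X p)"

definition coord :: "2 \<Rightarrow> real^2 \<Rightarrow> real^2" where
  "coord i p = axis i 1"

definition induced_metric :: "(real^2 \<Rightarrow> real^4) \<Rightarrow> real^2 \<Rightarrow> real^2^2" where
  "induced_metric r p = (\<chi> i j. E42_inner (push r (coord i) p) (push r (coord j) p))"

text \<open>\<open>christoffel r k i j\<close> is the Christoffel symbol with upper index \<open>k\<close> and lower indices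
  \<open>i\<close>, \<open>j\<close> of the induced metric.\<close>

definition christoffel :: "(real^2 \<Rightarrow> real^4) \<Rightarrow> 2 \<Rightarrow> 2 \<Rightarrow> 2 \<Rightarrow> real^2 \<Rightarrow> real" where
  "christoffel r k i j p =
     (1/2) * (\<Sum>l\<in>UNIV. matrix_inv (induced_metric r p) $ k $ l *
        (dir_deriv (coord i) (\<lambda>q. induced_metric r q $ j $ l) p
       + dir_deriv (coord j) (\<lambda>q. induced_metric r q $ i $ l) p
       - dir_deriv (coord l) (\<lambda>q. induced_metric r q $ i $ j) p))"

definition levi_civita ::
  "(real^2 \<Rightarrow> real^4) \<Rightarrow> (real^2 \<Rightarrow> real^2) \<Rightarrow> (real^2 \<Rightarrow> real^2) \<Rightarrow> real^2 \<Rightarrow> real^2" where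
  "levi_civita r X Y p =
     dir_deriv X Y p + (\<chi> k. \<Sum>i\<in>UNIV. \<Sum>j\<in>UNIV. christoffel r k i j p * X p $ i * Y p $ j)"

text \<open>The Gauss formula: the flat derivative of \<open>Y\<close> along \<open>X\<close> is \<open>\<nabla>\<^sub>X Y + h(X, Y)\<close>.\<close>

definition second_fund_form ::
  "(real^2 \<Rightarrow> real^4) \<Rightarrow> (real^2 \<Rightarrow> real^2) \<Rightarrow> (real^2 \<Rightarrow> real^2) \<Rightarrow> real^2 \<Rightarrow> real^4" where
  "second_fund_form r X Y p = dir_deriv X (push r Y) p - push r (levi_civita r X Y) p"

text \<open>
  In an adapted frame, \<open>e\<^sub>1, e\<^sub>2\<close> are \<open>push r (X 1), push r (X 2)\<close> and \<open>e\<^sub>3, e\<^sub>4\<close> are \<open>N 1, N 2\<close>.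
  The frame vectors may be of either causal character.
\<close>

definition tangent_frame :: "(real^2 \<Rightarrow> real^4) \<Rightarrow> (real^2) set \<Rightarrow> (2 \<Rightarrow> real^2 \<Rightarrow> real^2) \<Rightarrow> bool" where
  "tangent_frame r U X \<longleftrightarrow> open U \<and> (\<forall>i. smooth_on U (X i)) \<and>
     (\<forall>p\<in>U. (\<forall>i. \<bar>E42_inner (push r (X i) p) (push r (X i) p)\<bar> = 1) \<and>
             E42_inner (push r (X 1) p) (push r (X 2) p) = 0)"

definition adapted_frame ::
  "(real^2 \<Rightarrow> real^4) \<Rightarrow> (real^2) set \<Rightarrow> (2 \<Rightarrow> real^2 \<Rightarrow> real^2) \<Rightarrow> (2 \<Rightarrow> real^2 \<Rightarrow> real^4) \<Rightarrow> bool" where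
  "adapted_frame r U X N \<longleftrightarrow> tangent_frame r U X \<and> (\<forall>i. smooth_on U (N i)) \<and>
     (\<forall>p\<in>U. (\<forall>i. \<bar>E42_inner (N i p) (N i p)\<bar> = 1) \<and> E42_inner (N 1 p) (N 2 p) = 0 \<and>
             (\<forall>i j. E42_inner (push r (X i) p) (N j p) = 0) \<and>
             det (vector [push r (X 1) p, push r (X 2) p, N 1 p, N 2 p] :: real^4^4) > 0)"

definition frame_sign :: "(real^2 \<Rightarrow> real^4) \<Rightarrow> (real^2 \<Rightarrow> real^2) \<Rightarrow> real^2 \<Rightarrow> real" where
  "frame_sign r Z p = E42_inner (push r Z p) (push r Z p)"

definition mean_curvature :: "(real^2 \<Rightarrow> real^4) \<Rightarrow> (2 \<Rightarrow> real^2 \<Rightarrow> real^2) \<Rightarrow> real^2 \<Rightarrow> real^4" where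
  "mean_curvature r X p =
     (1/2) *\<^sub>R (\<Sum>i\<in>UNIV. frame_sign r (X i) p *\<^sub>R second_fund_form r (X i) (X i) p)"

definition zero_mean_curvature :: "(real^2 \<Rightarrow> real^4) \<Rightarrow> (real^2) set \<Rightarrow> bool" where
  "zero_mean_curvature r M \<longleftrightarrow>
     (\<forall>U X. U \<subseteq> M \<and> tangent_frame r U X \<longrightarrow> (\<forall>p\<in>U. mean_curvature r X p = 0))"

definition laplacian ::
  "(real^2 \<Rightarrow> real^4) \<Rightarrow> (2 \<Rightarrow> real^2 \<Rightarrow> real^2) \<Rightarrow> (real^2 \<Rightarrow> 'b::real_normed_vector) \<Rightarrow> real^2 \<Rightarrow> 'b" where
  "laplacian r X \<phi> p = (\<Sum>i\<in>UNIV. frame_sign r (X i) p *\<^sub>R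
     (dir_deriv (levi_civita r (X i) (X i)) \<phi> p - dir_deriv (X i) (dir_deriv (X i) \<phi>) p))"

text \<open>The second exterior power of \<open>real^4\<close>, realised as the 6-dimensional space of
  antisymmetric matrices. Its inner product plays no role in the notions below.\<close>

definition bivectors :: "(real^4^4) set" where
  "bivectors = {A. transpose A = - A}"

definition wedge :: "real^4 \<Rightarrow> real^4 \<Rightarrow> real^4^4" where
  "wedge u v = (\<chi> i j. u$i * v$j - u$j * v$i)"

text \<open>The Gauss map is determined by \<open>r\<close> up to sign on a connected \<open>M\<close>.\<close>

definition is_gauss_map :: "(real^2 \<Rightarrow> real^4) \<Rightarrow> (real^2) set \<Rightarrow> (real^2 \<Rightarrow> real^4^4) \<Rightarrow> bool" where
  "is_gauss_map r M \<nu> \<longleftrightarrow>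
     (\<forall>p\<in>M. \<exists>U X N. p \<in> U \<and> U \<subseteq> M \<and> adapted_frame r U X N \<and>
        (\<forall>q\<in>U. \<nu> q = wedge (N 1 q) (N 2 q)))"

definition pointwise_1_type_with :: "(real^2 \<Rightarrow> real^4) \<Rightarrow> (real^2) set \<Rightarrow> real^4^4 \<Rightarrow> bool" where
  "pointwise_1_type_with r M C \<longleftrightarrow>
     (\<exists>\<nu> f. is_gauss_map r M \<nu> \<and> smooth_on M (f :: real^2 \<Rightarrow> real) \<and>
        (\<forall>U X. U \<subseteq> M \<and> tangent_frame r U X \<longrightarrow>
           (\<forall>p\<in>U. laplacian r X \<nu> p = f p *\<^sub>R (\<nu> p + C))))"

definition pointwise_1_type_second_kind :: "(real^2 \<Rightarrow> real^4) \<Rightarrow> (real^2) set \<Rightarrow> bool" where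
  "pointwise_1_type_second_kind r M \<longleftrightarrow>
     (\<exists>C\<in>bivectors. C \<noteq> 0 \<and> pointwise_1_type_with r M C)"

definition open_part_of_plane :: "(real^4) set \<Rightarrow> bool" where
  "open_part_of_plane S \<longleftrightarrow>
     (\<exists>P. affine P \<and> aff_dim P = 2 \<and> openin (top_of_set P) S)"

text \<open>The rotational surface: the parameter \<open>p\<close> is \<open>(s, t)\<close>.\<close>

definition M1 :: "real \<Rightarrow> (real \<Rightarrow> real) \<Rightarrow> (real \<Rightarrow> real) \<Rightarrow> real^2 \<Rightarrow> real^4" where
  "M1 b y w p = (let s = p$1; t = p$2 in
     vector [w s * sinh t, y s * cosh (b * t), y s * sinh (b * t), w s * cosh t])"

definition M1_domain :: "real set \<Rightarrow> (real^2) set" where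
  "M1_domain I = {p. p$1 \<in> I}"

definition M1_regular :: "real \<Rightarrow> real set \<Rightarrow> (real \<Rightarrow> real) \<Rightarrow> (real \<Rightarrow> real) \<Rightarrow> bool" where
  "M1_regular b I y w \<longleftrightarrow>
     (\<forall>s\<in>I. (deriv y s)\<^sup>2 - (deriv w s)\<^sup>2 \<noteq> 0 \<and> (w s)\<^sup>2 - b\<^sup>2 * (y s)\<^sup>2 \<noteq> 0)"

text \<open>On \<open>M1 b y w\<close> the coordinate fields of \<open>s\<close> and \<open>t\<close> are orthogonal with squared lengths
  \<open>(y')\<^sup>2 - (w')\<^sup>2\<close> and \<open>w\<^sup>2 - b\<^sup>2 y\<^sup>2\<close>; the induced metric is Lorentzian iff their signs are opposite.\<close>

definition M1_timelike :: "real \<Rightarrow> real set \<Rightarrow> (real \<Rightarrow> real) \<Rightarrow> (real \<Rightarrow> real) \<Rightarrow> bool" where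
  "M1_timelike b I y w \<longleftrightarrow>
     (\<forall>s\<in>I. sgn ((deriv y s)\<^sup>2 - (deriv w s)\<^sup>2) * sgn ((w s)\<^sup>2 - b\<^sup>2 * (y s)\<^sup>2) = -1)"

end

theory Submission
  imports Defs
begin

text \<open>
  The six-dimensional space of bivectors splits into self-dual and anti-self-dual parts, and the
  Gauss map splits accordingly as one half of \<open>\<phi>\<^sub>+ + \<phi>\<^sub>-\<close>. With \<open>\<beta> = b\<close> or \<open>\<beta> = - b\<close>, each part has the form
  \<open>x J + z (cosh ((1 - \<beta>) t) P + sinh ((1 - \<beta>) t) Q)\<close> for constant bivectors \<open>J, P, Q\<close> and functions
  \<open>x, z\<close> of \<open>s\<close> with \<open>x\<^sup>2 - z\<^sup>2\<close> constant. On a surface of zero mean curvature \<open>x'\<close> and \<open>z'\<close> are multiples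
  of \<open>(\<beta> - 1) z\<^sup>2\<close> and \<open>(\<beta> - 1) x z\<close>, which makes each part an eigenfunction of the Laplacian:
  \<open>\<Delta>\<phi> = \<kappa>\<phi>\<close> with \<open>\<kappa>\<close> a multiple of \<open>(1 - \<beta>)\<^sup>2 z\<^sup>2\<close>. If \<open>(1 - \<beta>) z = 0\<close>, the part is
  constant and a multiple of it serves as \<open>C\<close>. Conversely, if \<open>C\<close> has a nonzero component in one of
  the two parts, then that part has a fixed direction wherever \<open>z \<noteq> 0\<close>, which is impossible for
  \<open>\<beta> \<noteq> 1\<close> because its direction moves with \<open>t\<close>. Finally \<open>z = 0\<close> means \<open>w y' + \<beta> y w' = 0\<close>, i.e. \<open>y |w|\<^sup>\<beta>\<close>
  is constant.
\<close>

section \<open>Smooth functions\<close>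

text \<open>Behind the eigenfunction property stands a known fact: the Gauss map of a surface of
  zero mean curvature is harmonic into the Grassmannian of 2-planes, which in dimension four is a
  product of two quadrics, one in each half of the bivectors; a harmonic map into a quadric is
  pointwise proportional to its Laplacian. Here this is verified by hand. The computation stays
  short because, with j^2 = 1, \<open>xc\<close> + j \<open>zc\<close> is the split-complex product
  (w + j \<beta> y)(w1 + j y1) divided by \<open>len_t\<close>. When one part is constant, removing
  it from the Gauss map leaves an eigenfunction, which is what C does. Two features of the
  definitions shape the rest. The equation is demanded for every tangent frame, so the Laplacian is
  first reduced to a coordinate expression from which the frame has disappeared. And a Gauss map is
  given only through local frames, so near each point it is compared, up to a sign, with one
  explicit map \<open>\<nu>\<^sub>0\<close>.\<close>

lemma Ck_on_cong:
  fixes f g :: "'a::real_normed_vector \<Rightarrow> 'b::real_normed_vector"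
  assumes "open S" "\<And>x. x \<in> S \<Longrightarrow> f x = g x" "Ck_on k f S"
  shows "Ck_on k g S"
  using assms(2,3)
proof (induction k arbitrary: f g)
  case 0
  then show ?case by (auto cong: continuous_on_cong)
next
  case (Suc k)
  have d: "(g has_derivative frechet_derivative f (at x)) (at x)" if "x \<in> S" for x
    by (rule has_derivative_transform_within_open[OF _ assms(1) that Suc.prems(1)])
      (use Suc.prems(2) that in \<open>simp_all add: frechet_derivative_works\<close>)
  have eq: "frechet_derivative f (at x) v = frechet_derivative g (at x) v" if "x \<in> S" for x v
    using frechet_derivative_at[OF d[OF that]] by simp
  have "Ck_on k (\<lambda>x. frechet_derivative g (at x) v) S" for v
    by (rule Suc.IH[OF eq]) (use Suc.prems(2) in auto)
  then show ?case
    using d by (auto simp: differentiable_def)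
qed

text \<open>\<open>Ck_on\<close> speaks of the choice-defined \<open>frechet_derivative\<close>; any
  explicit derivative agrees with it on the open set, and \<open>Ck_on_cong\<close> transfers the
  remaining orders. Most closure rules below go through this.\<close>

lemma Ck_on_Suc_derivI:
  fixes f :: "'a::real_normed_vector \<Rightarrow> 'b::real_normed_vector"
  assumes "open S" "\<And>x. x \<in> S \<Longrightarrow> (f has_derivative f' x) (at x)"
    and "\<And>v. Ck_on k (\<lambda>x. f' x v) S"
  shows "Ck_on (Suc k) f S"
proof -
  have eq: "f' x v = frechet_derivative f (at x) v" if "x \<in> S" for x v
    using frechet_derivative_at[OF assms(2)[OF that]] by simp
  have "Ck_on k (\<lambda>x. frechet_derivative f (at x) v) S" for v
    by (rule Ck_on_cong[OF assms(1) eq assms(3)])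
  then show ?thesis
    using assms(2) by (auto simp: differentiable_def)
qed

lemma Ck_on_Suc_has_derivative:
  "Ck_on (Suc k) f S \<Longrightarrow> x \<in> S \<Longrightarrow> (f has_derivative frechet_derivative f (at x)) (at x)"
  by (simp add: frechet_derivative_works)

lemma Ck_on_Suc_imp:
  "Ck_on (Suc k) f S \<Longrightarrow> Ck_on k f S"
proof (induction k arbitrary: f)
  case 0
  then show ?case
    by (auto intro!: continuous_at_imp_continuous_on differentiable_imp_continuous_within)
next
  case (Suc k)
  have "Ck_on k (\<lambda>x. frechet_derivative f (at x) v) S" for v
    by (rule Suc.IH) (use Suc.prems in auto)
  then show ?case using Suc.prems by auto
qed

lemma Ck_on_const: "open S \<Longrightarrow> Ck_on k (\<lambda>x. c) S"
proof (induction k arbitrary: c)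
  case (Suc k)
  show ?case
    by (rule Ck_on_Suc_derivI[where f' = "\<lambda>x v. 0"]) (use Suc in auto)
qed auto

lemma Ck_on_add:
  "open S \<Longrightarrow> Ck_on k f S \<Longrightarrow> Ck_on k g S \<Longrightarrow> Ck_on k (\<lambda>x. f x + g x) S"
proof (induction k arbitrary: f g)
  case (Suc k)
  show ?case
  proof (rule Ck_on_Suc_derivI)
    show "((\<lambda>x. f x + g x) has_derivative
        (\<lambda>v. frechet_derivative f (at x) v + frechet_derivative g (at x) v)) (at x)"
      if "x \<in> S" for x
      by (intro has_derivative_add Ck_on_Suc_has_derivative[OF _ that]) (use Suc in auto)
  qed (use Suc in auto)
qed (auto intro: continuous_intros)

lemma Ck_on_scaleR:
  fixes f :: "'a::real_normed_vector \<Rightarrow> real"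
  shows "open S \<Longrightarrow> Ck_on k f S \<Longrightarrow> Ck_on k g S \<Longrightarrow> Ck_on k (\<lambda>x. f x *\<^sub>R g x) S"
proof (induction k arbitrary: f g)
  case (Suc k)
  show ?case
  proof (rule Ck_on_Suc_derivI)
    show "((\<lambda>x. f x *\<^sub>R g x) has_derivative
        (\<lambda>v. f x *\<^sub>R frechet_derivative g (at x) v + frechet_derivative f (at x) v *\<^sub>R g x)) (at x)"
      if "x \<in> S" for x
      by (intro has_derivative_scaleR Ck_on_Suc_has_derivative[OF _ that]) (use Suc in auto)
    show "Ck_on k (\<lambda>x. f x *\<^sub>R frechet_derivative g (at x) v + frechet_derivative f (at x) v *\<^sub>R g x) S" for v
      using Suc.prems by (intro Ck_on_add Suc.IH Ck_on_Suc_imp[of k f] Ck_on_Suc_imp[of k g]) auto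
  qed (use Suc in auto)
qed (auto intro: continuous_intros)

lemma Ck_on_mult:
  fixes f :: "'a::real_normed_vector \<Rightarrow> real"
  shows "open S \<Longrightarrow> Ck_on k f S \<Longrightarrow> Ck_on k g S \<Longrightarrow> Ck_on k (\<lambda>x. f x * g x) S"
  using Ck_on_scaleR[of S k f g] by simp

text \<open>The derivative contains \<open>inverse (f x)\<close> itself, so the induction on the
  order closes with \<open>f\<close> fixed. The square root follows the same pattern.\<close>

lemma Ck_on_inverse:
  fixes f :: "'a::real_normed_vector \<Rightarrow> real"
  assumes "\<And>x. x \<in> S \<Longrightarrow> f x \<noteq> 0"
  shows "open S \<Longrightarrow> Ck_on k f S \<Longrightarrow> Ck_on k (\<lambda>x. inverse (f x)) S"
proof (induction k)
  case 0
  then show ?case using assms by (auto intro!: continuous_intros)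
next
  case (Suc k)
  show ?case
  proof (rule Ck_on_Suc_derivI)
    show "((\<lambda>x. inverse (f x)) has_derivative
        (\<lambda>v. (-1) * (inverse (f x) * (frechet_derivative f (at x) v * inverse (f x))))) (at x)"
      if "x \<in> S" for x
      using Ck_on_Suc_has_derivative[OF Suc.prems(2) that] assms[OF that]
      by (auto intro!: derivative_eq_intros)
    show "Ck_on k (\<lambda>x. (-1) * (inverse (f x) * (frechet_derivative f (at x) v * inverse (f x)))) S" for v
      using Suc.prems Ck_on_Suc_imp[OF Suc.prems(2)]
      by (intro Ck_on_mult Ck_on_const Suc.IH) auto
  qed (use Suc in auto)
qed

lemma Ck_on_sqrt:
  fixes f :: "'a::real_normed_vector \<Rightarrow> real"
  assumes "\<And>x. x \<in> S \<Longrightarrow> f x > 0"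
  shows "open S \<Longrightarrow> Ck_on k f S \<Longrightarrow> Ck_on k (\<lambda>x. sqrt (f x)) S"
proof (induction k)
  case 0
  then show ?case by (auto intro!: continuous_intros)
next
  case (Suc k)
  show ?case
  proof (rule Ck_on_Suc_derivI)
    show "((\<lambda>x. sqrt (f x)) has_derivative
        (\<lambda>v. (1/2) * (frechet_derivative f (at x) v * inverse (sqrt (f x))))) (at x)"
      if "x \<in> S" for x
      using Ck_on_Suc_has_derivative[OF Suc.prems(2) that] assms[OF that]
      by (auto intro!: derivative_eq_intros simp: fun_eq_iff field_simps)
    show "Ck_on k (\<lambda>x. (1/2) * (frechet_derivative f (at x) v * inverse (sqrt (f x)))) S" for v
      using Suc.prems Ck_on_Suc_imp[OF Suc.prems(2)]
      by (intro Ck_on_mult Ck_on_const Ck_on_inverse Suc.IH) (auto dest: assms)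
  qed (use Suc in auto)
qed

lemma frechet_derivative_DERIV:
  fixes f :: "real \<Rightarrow> real"
  assumes "f differentiable (at x)"
  shows "(f has_real_derivative frechet_derivative f (at x) 1) (at x)"
proof -
  have d: "(f has_derivative frechet_derivative f (at x)) (at x)"
    using assms by (simp add: frechet_derivative_works)
  have "frechet_derivative f (at x) v = frechet_derivative f (at x) 1 * v" for v
    using linear_scale[OF has_derivative_linear[OF d], of v 1] by simp
  then have "frechet_derivative f (at x) = (\<lambda>v. frechet_derivative f (at x) 1 * v)"
    by blast
  then show ?thesis
    using d unfolding has_field_derivative_def by metis
qed

lemmas has_derivative_vec_nth [derivative_intros] =
  bounded_linear.has_derivative[OF bounded_linear_vec_nth]

text \<open>The derivative in direction v is \<open>v$1\<close> times a function of the same shape,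
  with the derivative of f in place of f; hence the induction over arbitrary f.\<close>

lemma Ck_on_fst_component:
  fixes f :: "real \<Rightarrow> real"
  assumes "open I"
  shows "Ck_on k f I \<Longrightarrow> Ck_on k (\<lambda>p::real^2. f (p$1)) {p. p$1 \<in> I}"
proof (induction k arbitrary: f)
  case 0
  then show ?case by (auto intro!: continuous_on_compose2[of I f] continuous_intros)
next
  case (Suc k)
  have o: "open {p::real^2. p$1 \<in> I}"
    using assms by (rule open_vimage[unfolded vimage_def]) (auto intro: continuous_intros)
  show ?case
  proof (rule Ck_on_Suc_derivI)
    show "((\<lambda>p. f (p$1)) has_derivative
        (\<lambda>v. v$1 * frechet_derivative f (at (p$1)) 1)) (at p)"
      if "p \<in> {p. p$1 \<in> I}" for p :: "real^2"
      by (rule DERIV_compose_FDERIV[OF frechet_derivative_DERIV])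
        (use Suc.prems that in \<open>auto intro!: derivative_eq_intros\<close>)
    show "Ck_on k (\<lambda>p::real^2. v$1 * frechet_derivative f (at (p$1)) 1) {p. p$1 \<in> I}" for v :: "real^2"
      using Suc.prems by (intro Ck_on_mult Ck_on_const o Suc.IH) auto
  qed (use Suc o in auto)
qed

text \<open>Each of the two functions is a factor in the derivative of the other, so their orders
  are raised together.\<close>

lemma Ck_on_cosh_sinh:
  fixes c :: real
  assumes "open S"
  shows "Ck_on k (\<lambda>p::real^2. cosh (c * p$2)) S \<and> Ck_on k (\<lambda>p::real^2. sinh (c * p$2)) S"
proof (induction k)
  case 0
  then show ?case by (auto intro!: continuous_intros)
next
  case (Suc k)
  have "Ck_on (Suc k) (\<lambda>p::real^2. cosh (c * p$2)) S"
  proof (rule Ck_on_Suc_derivI)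
    show "((\<lambda>p. cosh (c * p$2)) has_derivative (\<lambda>v. (c * v$2) * sinh (c * p$2))) (at p)" for p :: "real^2"
      by (rule DERIV_compose_FDERIV[where f = cosh]) (auto intro!: derivative_eq_intros)
  qed (use Suc assms in \<open>auto intro!: Ck_on_mult Ck_on_const\<close>)
  moreover have "Ck_on (Suc k) (\<lambda>p::real^2. sinh (c * p$2)) S"
  proof (rule Ck_on_Suc_derivI)
    show "((\<lambda>p. sinh (c * p$2)) has_derivative (\<lambda>v. (c * v$2) * cosh (c * p$2))) (at p)" for p :: "real^2"
      by (rule DERIV_compose_FDERIV[where f = sinh]) (auto intro!: derivative_eq_intros)
  qed (use Suc assms in \<open>auto intro!: Ck_on_mult Ck_on_const\<close>)
  ultimately show ?case by blast
qed

lemma smooth_on_deriv: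
  fixes f :: "real \<Rightarrow> real"
  assumes "open S" "smooth_on S f"
  shows "smooth_on S (deriv f)"
proof -
  have "Ck_on k (\<lambda>x. frechet_derivative f (at x) 1) S" for k
    using assms(2) unfolding smooth_on_def by (metis Ck_on.simps(2))
  moreover have "frechet_derivative f (at x) 1 = deriv f x" if "x \<in> S" for x
    using assms(2) that unfolding smooth_on_def
    by (metis Ck_on.simps(2) DERIV_imp_deriv frechet_derivative_DERIV)
  ultimately show ?thesis
    unfolding smooth_on_def
    using Ck_on_cong[OF assms(1), of "\<lambda>x. frechet_derivative f (at x) 1" "deriv f"] by auto
qed

lemma smooth_on_imp_DERIV:
  fixes f :: "real \<Rightarrow> real"
  assumes "smooth_on S f" "x \<in> S"
  shows "(f has_real_derivative deriv f x) (at x)"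
proof -
  have "f differentiable (at x)"
    using assms unfolding smooth_on_def by (metis Ck_on.simps(2))
  then show ?thesis
    by (metis DERIV_deriv_iff_real_differentiable)
qed

lemma smooth_on_differentiable:
  "smooth_on S f \<Longrightarrow> x \<in> S \<Longrightarrow> f differentiable (at x)"
  unfolding smooth_on_def by (metis Ck_on.simps(2))

lemma smooth_on_imp_continuous_on: "smooth_on S f \<Longrightarrow> continuous_on S f"
  unfolding smooth_on_def by (metis Ck_on.simps(1))

lemma smooth_on_const: "open S \<Longrightarrow> smooth_on S (\<lambda>x. c)"
  and smooth_on_add:
    "open S \<Longrightarrow> smooth_on S f \<Longrightarrow> smooth_on S g \<Longrightarrow> smooth_on S (\<lambda>x. f x + g x)"
  and smooth_on_scaleR:
    "open S \<Longrightarrow> smooth_on S h \<Longrightarrow> smooth_on S f \<Longrightarrow> smooth_on S (\<lambda>x. h x *\<^sub>R f x)"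
  and smooth_on_mult:
    "open S \<Longrightarrow> smooth_on S h \<Longrightarrow> smooth_on S k \<Longrightarrow> smooth_on S (\<lambda>x. h x * k x)"
  and smooth_on_inverse:
    "open S \<Longrightarrow> (\<And>x. x \<in> S \<Longrightarrow> h x \<noteq> 0) \<Longrightarrow> smooth_on S h \<Longrightarrow> smooth_on S (\<lambda>x. inverse (h x))"
  and smooth_on_sqrt:
    "open S \<Longrightarrow> (\<And>x. x \<in> S \<Longrightarrow> h x > 0) \<Longrightarrow> smooth_on S h \<Longrightarrow> smooth_on S (\<lambda>x. sqrt (h x))"
  for f g :: "'a::real_normed_vector \<Rightarrow> 'b::real_normed_vector"
    and h k :: "'a \<Rightarrow> real"
  unfolding smooth_on_def
  by (simp_all add: Ck_on_const Ck_on_add Ck_on_scaleR Ck_on_mult Ck_on_inverse Ck_on_sqrt)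

lemma smooth_on_minus:
  fixes f :: "'a::real_normed_vector \<Rightarrow> 'b::real_normed_vector"
  assumes "open S" "smooth_on S f"
  shows "smooth_on S (\<lambda>x. - f x)"
  using smooth_on_scaleR[OF assms(1) smooth_on_const[OF assms(1), of "-1"] assms(2)] by simp

lemma smooth_on_diff:
  fixes f g :: "'a::real_normed_vector \<Rightarrow> 'b::real_normed_vector"
  assumes "open S" "smooth_on S f" "smooth_on S g"
  shows "smooth_on S (\<lambda>x. f x - g x)"
  using smooth_on_add[OF assms(1,2) smooth_on_minus[OF assms(1,3)]] by simp

lemma smooth_on_divide:
  fixes f g :: "'a::real_normed_vector \<Rightarrow> real"
  assumes "open S" "\<And>x. x \<in> S \<Longrightarrow> g x \<noteq> 0" "smooth_on S f" "smooth_on S g"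
  shows "smooth_on S (\<lambda>x. f x / g x)"
  using smooth_on_mult[OF assms(1,3) smooth_on_inverse[OF assms(1,2,4)]] by (simp add: divide_inverse)

lemma smooth_on_power:
  fixes f :: "'a::real_normed_vector \<Rightarrow> real"
  shows "open S \<Longrightarrow> smooth_on S f \<Longrightarrow> smooth_on S (\<lambda>x. f x ^ n)"
  by (induction n) (auto intro: smooth_on_const smooth_on_mult)

lemma smooth_on_fst_component:
  fixes f :: "real \<Rightarrow> real"
  shows "open I \<Longrightarrow> smooth_on I f \<Longrightarrow> smooth_on (M1_domain I) (\<lambda>p. f (p$1))"
  unfolding smooth_on_def M1_domain_def by (auto intro: Ck_on_fst_component)

lemma smooth_on_cosh: "open S \<Longrightarrow> smooth_on S (\<lambda>p::real^2. cosh (c * p$2))"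
  and smooth_on_sinh: "open S \<Longrightarrow> smooth_on S (\<lambda>p::real^2. sinh (c * p$2))"
  unfolding smooth_on_def by (auto simp: Ck_on_cosh_sinh)

lemma open_M1_domain: "open I \<Longrightarrow> open (M1_domain I)"
  unfolding M1_domain_def
  by (rule open_vimage[unfolded vimage_def]) (auto intro: continuous_intros)

section \<open>Linear algebra\<close>

lemma vector_4 [simp]:
  "(vector [x,y,z,t] :: ('a::zero)^4)$1 = x"
  "(vector [x,y,z,t] :: ('a::zero)^4)$2 = y"
  "(vector [x,y,z,t] :: ('a::zero)^4)$3 = z"
  "(vector [x,y,z,t] :: ('a::zero)^4)$4 = t"
  unfolding vector_def by simp_all

lemma det_4:
  "det (A::'a::comm_ring_1^4^4) =
    A$1$1 * (A$2$2 * A$3$3 * A$4$4 + A$2$3 * A$3$4 * A$4$2 + A$2$4 * A$3$2 * A$4$3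
      - A$2$2 * A$3$4 * A$4$3 - A$2$3 * A$3$2 * A$4$4 - A$2$4 * A$3$3 * A$4$2)
  - A$1$2 * (A$2$1 * A$3$3 * A$4$4 + A$2$3 * A$3$4 * A$4$1 + A$2$4 * A$3$1 * A$4$3
      - A$2$1 * A$3$4 * A$4$3 - A$2$3 * A$3$1 * A$4$4 - A$2$4 * A$3$3 * A$4$1)
  + A$1$3 * (A$2$1 * A$3$2 * A$4$4 + A$2$2 * A$3$4 * A$4$1 + A$2$4 * A$3$1 * A$4$2
      - A$2$1 * A$3$4 * A$4$2 - A$2$2 * A$3$1 * A$4$4 - A$2$4 * A$3$2 * A$4$1)
  - A$1$4 * (A$2$1 * A$3$2 * A$4$3 + A$2$2 * A$3$3 * A$4$1 + A$2$3 * A$3$1 * A$4$2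
      - A$2$1 * A$3$3 * A$4$2 - A$2$2 * A$3$1 * A$4$3 - A$2$3 * A$3$2 * A$4$1)"
proof -
  have f1: "finite {2::4, 3, 4}" "1 \<notin> {2::4, 3, 4}" by auto
  have f2: "finite {3::4, 4}" "2 \<notin> {3::4, 4}" by auto
  have f3: "finite {4::4}" "3 \<notin> {4::4}" by auto
  show ?thesis
    unfolding det_def UNIV_4
    unfolding sum_over_permutations_insert[OF f1]
    unfolding sum_over_permutations_insert[OF f2]
    unfolding sum_over_permutations_insert[OF f3]
    unfolding permutes_sing
    by (simp add: sign_swap_id permutation_swap_id permutation_compose sign_compose sign_id
        swap_id_eq algebra_simps)
qed

text \<open>\<open>matrix_inv\<close> is defined by choice; for square matrices a right inverse is
  two-sided, which pins the choice down.\<close>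

lemma matrix_inv_eqI:
  fixes A :: "real^'n^'n"
  assumes "A ** B = mat 1"
  shows "matrix_inv A = B"
proof -
  have "B ** A = mat 1"
    using assms matrix_left_right_inverse by blast
  then have "\<exists>B. A ** B = mat 1 \<and> B ** A = mat 1"
    using assms by blast
  then have "matrix_inv A ** A = mat 1"
    unfolding matrix_inv_def by (metis (mono_tags, lifting) someI_ex)
  then show ?thesis
    by (metis assms matrix_mul_assoc matrix_mul_lid matrix_mul_rid)
qed

lemma matrix_inv_diagonal_2:
  fixes a d :: real
  assumes "a \<noteq> 0" "d \<noteq> 0"
  shows "matrix_inv (\<chi> i j. if i = j then if i = 1 then a else d else 0 :: real^2^2) =
    (\<chi> i j. if i = j then if i = 1 then 1 / a else 1 / d else 0)"
  by (rule matrix_inv_eqI)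
    (use assms in \<open>simp add: vec_eq_iff matrix_matrix_mult_def mat_def forall_2 sum_2\<close>)

text \<open>The hypotheses say \<open>M diag(E, G) M\<^sup>T = diag(\<epsilon>, \<epsilon>')\<close> for the matrix \<open>M\<close> of the frame; inverting this
  expresses the inverse metric through the frame.\<close>

lemma pseudo_orthonormal_frame_2:
  fixes a c a' c' E G \<epsilon> \<epsilon>' :: real
  assumes "E * a\<^sup>2 + G * c\<^sup>2 = \<epsilon>" "E * a'\<^sup>2 + G * c'\<^sup>2 = \<epsilon>'" "E * a * a' + G * c * c' = 0"
    and "\<bar>\<epsilon>\<bar> = 1" "\<bar>\<epsilon>'\<bar> = 1" and nz: "E \<noteq> 0" "G \<noteq> 0"
  shows "\<epsilon> * a\<^sup>2 + \<epsilon>' * a'\<^sup>2 = 1 / E" "\<epsilon> * c\<^sup>2 + \<epsilon>' * c'\<^sup>2 = 1 / G"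
    "\<epsilon> * a * c + \<epsilon>' * a' * c' = 0"
proof -
  have sq: "\<epsilon> * \<epsilon> = 1" "\<epsilon>' * \<epsilon>' = 1"
    using assms(4,5) by (metis abs_mult_self_eq mult_1)+
  define M where "M = (vector [vector [a, c], vector [a', c']] :: real^2^2)"
  \<comment> \<open>The right inverse predicted by the hypotheses: diag(E, G) times the transpose of
    \<open>M\<close> times diag(\<epsilon>, \<epsilon>'). The claims are read off from its being a
    left inverse too.\<close>
  define N where "N = (vector [vector [E * a * \<epsilon>, E * a' * \<epsilon>'],
    vector [G * c * \<epsilon>, G * c' * \<epsilon>']] :: real^2^2)"
  have "a * (E * a * \<epsilon>) + c * (G * c * \<epsilon>) = (E * a\<^sup>2 + G * c\<^sup>2) * \<epsilon>"
    "a' * (E * a' * \<epsilon>') + c' * (G * c' * \<epsilon>') = (E * a'\<^sup>2 + G * c'\<^sup>2) * \<epsilon>'"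
    "a * (E * a' * \<epsilon>') + c * (G * c' * \<epsilon>') = (E * a * a' + G * c * c') * \<epsilon>'"
    "a' * (E * a * \<epsilon>) + c' * (G * c * \<epsilon>) = (E * a * a' + G * c * c') * \<epsilon>"
    by (simp_all add: algebra_simps power2_eq_square)
  then have "M ** N = mat 1"
    unfolding M_def N_def assms(1-3) sq
    by (simp add: vec_eq_iff matrix_matrix_mult_def mat_def forall_2 sum_2)
  then have "N ** M = mat 1"
    using matrix_left_right_inverse by blast
  then have *: "E * (\<epsilon> * a\<^sup>2 + \<epsilon>' * a'\<^sup>2) = 1" "E * (\<epsilon> * a * c + \<epsilon>' * a' * c') = 0"
     "G * (\<epsilon> * c\<^sup>2 + \<epsilon>' * c'\<^sup>2) = 1"
    unfolding M_def N_def
    by (simp_all add: vec_eq_iff matrix_matrix_mult_def mat_def forall_2 sum_2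
        power2_eq_square algebra_simps)
  show "\<epsilon> * a\<^sup>2 + \<epsilon>' * a'\<^sup>2 = 1 / E" "\<epsilon> * c\<^sup>2 + \<epsilon>' * c'\<^sup>2 = 1 / G"
    using *(1,3) nz by (simp_all add: nonzero_eq_divide_eq mult.commute)
  show "\<epsilon> * a * c + \<epsilon>' * a' * c' = 0"
    using *(2) nz(1) by simp
qed

section \<open>The Laplacian of a rotational surface\<close>

text \<open>Full differentiability with the two partials named: frame fields differentiate in
  arbitrary directions, so mere existence of partial derivatives would not do.\<close>

definition has_partials ::
  "(real^2 \<Rightarrow> 'b::real_normed_vector) \<Rightarrow> real^2 \<Rightarrow> 'b \<Rightarrow> 'b \<Rightarrow> bool" where
  "has_partials \<phi> p a c \<longleftrightarrow> (\<phi> has_derivative (\<lambda>h. h$1 *\<^sub>R a + h$2 *\<^sub>R c)) (at p)"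

lemma has_partials_dir_deriv:
  "has_partials \<phi> p a c \<Longrightarrow> dir_deriv X \<phi> p = X p $ 1 *\<^sub>R a + X p $ 2 *\<^sub>R c"
  unfolding has_partials_def dir_deriv_def by (drule frechet_derivative_at, drule sym, simp)

lemma has_partials_add:
  "has_partials \<phi> p a c \<Longrightarrow> has_partials \<psi> p a' c' \<Longrightarrow>
    has_partials (\<lambda>q. \<phi> q + \<psi> q) p (a + a') (c + c')"
  unfolding has_partials_def
  by (drule (1) has_derivative_add) (simp add: algebra_simps)

lemma has_partials_cong:
  assumes "has_partials \<phi> p a c" "open U" "p \<in> U" "\<And>q. q \<in> U \<Longrightarrow> \<phi> q = \<psi> q"
  shows "has_partials \<psi> p a c"
  using assms unfolding has_partials_def by (rule has_derivative_transform_within_open)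

text \<open>The parametrization and the parts of the Gauss map are sums of terms f(s) g(t) v, so
  their partials come down to one-variable derivatives.\<close>

lemma has_partials_separated:
  fixes f g :: "real \<Rightarrow> real"
  assumes "(f has_real_derivative f') (at (p$1))" "(g has_real_derivative g') (at (p$2))"
  shows "has_partials (\<lambda>q. (f (q$1) * g (q$2)) *\<^sub>R v) p ((f' * g (p$2)) *\<^sub>R v) ((f (p$1) * g') *\<^sub>R v)"
proof -
  have "((\<lambda>q. f (q$1)) has_derivative (\<lambda>h. h$1 * f')) (at p)"
    by (rule DERIV_compose_FDERIV[where f = f and g = "\<lambda>q. q$1"])
      (auto intro!: assms derivative_eq_intros)
  moreover have "((\<lambda>q. g (q$2)) has_derivative (\<lambda>h. h$2 * g')) (at p)"
    by (rule DERIV_compose_FDERIV[where f = g and g = "\<lambda>q. q$2"])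
      (auto intro!: assms derivative_eq_intros)
  ultimately show ?thesis
    unfolding has_partials_def
    by (auto intro!: derivative_eq_intros simp: algebra_simps)
qed

lemma has_partials_separated_fst:
  fixes f :: "real \<Rightarrow> real"
  assumes "(f has_real_derivative f') (at (p$1))"
  shows "has_partials (\<lambda>q. f (q$1)) p f' 0"
  using has_partials_separated[OF assms DERIV_const, of 1 "1::real"] by simp

locale rotational_surface =
  fixes b :: real and I :: "real set" and y w :: "real \<Rightarrow> real"
  assumes open_I: "open I" and interval_I: "is_interval I" and nonempty_I: "I \<noteq> {}"
    and smooth_y: "smooth_on I y" and smooth_w: "smooth_on I w"
    and regular: "M1_regular b I y w"
begin

text \<open>\<open>E\<close> and \<open>G\<close> are the diagonal coefficients of the induced
  metric in closed form (\<open>induced_metric_r\<close>); that they depend on s alone is what keeps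
  the Christoffel symbols few.\<close>

definition E :: "real \<Rightarrow> real" where "E s = (deriv y s)\<^sup>2 - (deriv w s)\<^sup>2"
definition G :: "real \<Rightarrow> real" where "G s = (w s)\<^sup>2 - b\<^sup>2 * (y s)\<^sup>2"

lemma E_nz: "s \<in> I \<Longrightarrow> E s \<noteq> 0" and G_nz: "s \<in> I \<Longrightarrow> G s \<noteq> 0"
  using regular unfolding M1_regular_def E_def G_def by auto

lemmas smooth_profile = smooth_y smooth_w smooth_on_deriv[OF open_I smooth_y]
  smooth_on_deriv[OF open_I smooth_w]

lemma smooth_E: "smooth_on I E"
  unfolding E_def[abs_def] by (intro smooth_on_diff smooth_on_power open_I smooth_profile)

lemma smooth_G: "smooth_on I G"
  unfolding G_def[abs_def]
  by (intro smooth_on_diff smooth_on_mult smooth_on_const smooth_on_power open_I smooth_profile)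

lemmas DERIV_profile = smooth_profile[THEN smooth_on_imp_DERIV]
lemmas DERIV_E = smooth_on_imp_DERIV[OF smooth_E]
lemmas DERIV_G = smooth_on_imp_DERIV[OF smooth_G]

abbreviation "r \<equiv> M1 b y w"

lemma M1_separated:
  "r = (\<lambda>q. (w (q$1) * sinh (q$2)) *\<^sub>R axis 1 1 + (w (q$1) * cosh (q$2)) *\<^sub>R axis 4 1
    + (y (q$1) * cosh (b * q$2)) *\<^sub>R axis 2 1 + (y (q$1) * sinh (b * q$2)) *\<^sub>R axis 3 1)"
  by (simp add: fun_eq_iff M1_def Let_def vec_eq_iff forall_4 axis_def)

definition rs :: "real^2 \<Rightarrow> real^4" where
  "rs q = vector [deriv w (q$1) * sinh (q$2), deriv y (q$1) * cosh (b * q$2),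
    deriv y (q$1) * sinh (b * q$2), deriv w (q$1) * cosh (q$2)]"

definition rt :: "real^2 \<Rightarrow> real^4" where
  "rt q = vector [w (q$1) * cosh (q$2), b * y (q$1) * sinh (b * q$2),
    b * y (q$1) * cosh (b * q$2), w (q$1) * sinh (q$2)]"

lemma has_partials_r:
  assumes "q \<in> M1_domain I"
  shows "has_partials r q (rs q) (rt q)"
proof -
  have s: "q$1 \<in> I" using assms by (simp add: M1_domain_def)
  have "has_partials r q
    ((deriv w (q$1) * sinh (q$2)) *\<^sub>R axis 1 1 + (deriv w (q$1) * cosh (q$2)) *\<^sub>R axis 4 1
      + (deriv y (q$1) * cosh (b * q$2)) *\<^sub>R axis 2 1 + (deriv y (q$1) * sinh (b * q$2)) *\<^sub>R axis 3 1)
    ((w (q$1) * cosh (q$2)) *\<^sub>R axis 1 1 + (w (q$1) * sinh (q$2)) *\<^sub>R axis 4 1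
      + (y (q$1) * (b * sinh (b * q$2))) *\<^sub>R axis 2 1 + (y (q$1) * (b * cosh (b * q$2))) *\<^sub>R axis 3 1)"
    unfolding M1_separated
    by (intro has_partials_add has_partials_separated DERIV_profile s)
      (auto intro!: derivative_eq_intros)
  moreover have "(deriv w (q$1) * sinh (q$2)) *\<^sub>R axis 1 1 + (deriv w (q$1) * cosh (q$2)) *\<^sub>R axis 4 1
      + (deriv y (q$1) * cosh (b * q$2)) *\<^sub>R axis 2 1 + (deriv y (q$1) * sinh (b * q$2)) *\<^sub>R axis 3 1 = rs q"
    "(w (q$1) * cosh (q$2)) *\<^sub>R axis 1 1 + (w (q$1) * sinh (q$2)) *\<^sub>R axis 4 1
      + (y (q$1) * (b * sinh (b * q$2))) *\<^sub>R axis 2 1 + (y (q$1) * (b * cosh (b * q$2))) *\<^sub>R axis 3 1 = rt q"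
    by (simp_all add: rs_def rt_def vec_eq_iff forall_4 axis_def)
  ultimately show ?thesis by simp
qed

lemma push_eq_dir_deriv: "push r X = dir_deriv X r"
  by (simp add: push_def dir_deriv_def fun_eq_iff)

lemma push_r:
  "q \<in> M1_domain I \<Longrightarrow> push r X q = X q $ 1 *\<^sub>R rs q + X q $ 2 *\<^sub>R rt q"
  unfolding push_eq_dir_deriv by (rule has_partials_dir_deriv[OF has_partials_r])

lemma inner_rs_rt:
  "E42_inner (rs q) (rs q) = E (q$1)" "E42_inner (rt q) (rt q) = G (q$1)"
  "E42_inner (rs q) (rt q) = 0" "E42_inner (rt q) (rs q) = 0"
proof -
  have h: "(cosh x)\<^sup>2 = (sinh x)\<^sup>2 + 1" for x :: real
    by (simp add: cosh_square_eq)
  show "E42_inner (rs q) (rs q) = E (q$1)" "E42_inner (rt q) (rt q) = G (q$1)"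
    unfolding E42_inner_def rs_def rt_def E_def G_def vector_4
    using h[of "q$2"] h[of "b * q$2"] by (algebra, algebra)
  show "E42_inner (rs q) (rt q) = 0" "E42_inner (rt q) (rs q) = 0"
    by (simp_all add: E42_inner_def rs_def rt_def)
qed

lemma E42_inner_tangent:
  "E42_inner (a *\<^sub>R rs q + c *\<^sub>R rt q) (a' *\<^sub>R rs q + c' *\<^sub>R rt q) =
    E (q$1) * a * a' + G (q$1) * c * c'"
proof -
  have "E42_inner (a *\<^sub>R rs q + c *\<^sub>R rt q) (a' *\<^sub>R rs q + c' *\<^sub>R rt q) =
      a * a' * E42_inner (rs q) (rs q) + c * c' * E42_inner (rt q) (rt q)
      + (a * c' + c * a') * E42_inner (rs q) (rt q)"
    unfolding E42_inner_def by (simp add: algebra_simps)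
  then show ?thesis by (simp add: inner_rs_rt)
qed

lemma induced_metric_r:
  assumes "q \<in> M1_domain I"
  shows "induced_metric r q = (\<chi> i j. if i = j then if i = 1 then E (q$1) else G (q$1) else 0)"
  using E42_inner_tangent[of 1 q 0 1 0] E42_inner_tangent[of 1 q 0 0 1]
    E42_inner_tangent[of 0 q 1 1 0] E42_inner_tangent[of 0 q 1 0 1]
  by (simp add: induced_metric_def vec_eq_iff forall_2 push_r[OF assms] coord_def axis_def)

lemma christoffel_r:
  assumes p: "p \<in> M1_domain I"
  defines "s \<equiv> p$1"
  shows "christoffel r 1 1 1 p = deriv E s / (2 * E s)"
    "christoffel r 1 2 2 p = - deriv G s / (2 * E s)"
    "christoffel r 1 1 2 p = 0" "christoffel r 1 2 1 p = 0"
    "christoffel r 2 1 1 p = 0" "christoffel r 2 2 2 p = 0"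
    "christoffel r 2 1 2 p = deriv G s / (2 * G s)"
    "christoffel r 2 2 1 p = deriv G s / (2 * G s)"
proof -
  have s: "p$1 \<in> I" using p by (simp add: M1_domain_def)
  note o = open_M1_domain[OF open_I]
  have E: "has_partials (\<lambda>q. induced_metric r q $ 1 $ 1) p (deriv E s) 0"
    unfolding s_def
    by (rule has_partials_cong[OF has_partials_separated_fst[OF DERIV_E[OF s]] o p])
      (simp add: induced_metric_r)
  have G: "has_partials (\<lambda>q. induced_metric r q $ 2 $ 2) p (deriv G s) 0"
    unfolding s_def
    by (rule has_partials_cong[OF has_partials_separated_fst[OF DERIV_G[OF s]] o p])
      (simp add: induced_metric_r)
  have Z: "has_partials (\<lambda>q. 0::real) p 0 0"
    by (simp add: has_partials_def)
  have Z1: "has_partials (\<lambda>q. induced_metric r q $ 1 $ 2) p 0 0"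
    by (rule has_partials_cong[OF Z o p]) (simp add: induced_metric_r)
  have Z2: "has_partials (\<lambda>q. induced_metric r q $ 2 $ 1) p 0 0"
    by (rule has_partials_cong[OF Z o p]) (simp add: induced_metric_r)
  note sm = christoffel_def sum_2 has_partials_dir_deriv[OF E] has_partials_dir_deriv[OF G]
    has_partials_dir_deriv[OF Z1] has_partials_dir_deriv[OF Z2]
    induced_metric_r[OF p] matrix_inv_diagonal_2[OF E_nz[OF s] G_nz[OF s]] coord_def axis_def
  show "christoffel r 1 1 1 p = deriv E s / (2 * E s)"
    "christoffel r 1 2 2 p = - deriv G s / (2 * E s)"
    "christoffel r 1 1 2 p = 0" "christoffel r 1 2 1 p = 0"
    "christoffel r 2 1 1 p = 0" "christoffel r 2 2 2 p = 0"
    "christoffel r 2 1 2 p = deriv G s / (2 * G s)"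
    "christoffel r 2 2 1 p = deriv G s / (2 * G s)"
    by (simp_all add: sm s_def)
qed

text \<open>The mixed second derivatives do not enter, as the coordinate fields are orthogonal.\<close>

definition has_laplacian :: "(real^2 \<Rightarrow> 'b::real_normed_vector) \<Rightarrow> real^2 \<Rightarrow> 'b \<Rightarrow> bool" where
  "has_laplacian \<phi> p L \<longleftrightarrow> (\<exists>U \<phi>s \<phi>t \<phi>ss \<phi>st \<phi>ts \<phi>tt. open U \<and> p \<in> U \<and>
     (\<forall>q\<in>U. has_partials \<phi> q (\<phi>s q) (\<phi>t q)) \<and>
     has_partials \<phi>s p \<phi>ss \<phi>st \<and> has_partials \<phi>t p \<phi>ts \<phi>tt \<and>
     L = - ((1 / E (p$1)) *\<^sub>R (\<phi>ss - (deriv E (p$1) / (2 * E (p$1))) *\<^sub>R \<phi>s p)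
          + (1 / G (p$1)) *\<^sub>R (\<phi>tt + (deriv G (p$1) / (2 * E (p$1))) *\<^sub>R \<phi>s p)))"

text \<open>Only the values of the frame components at p survive, and they enter through
  sign-weighted sums of products, which \<open>pseudo_orthonormal_frame_2\<close> identifies with
  the entries of the inverse metric. Hence all tangent frames give the same coordinate
  expression.\<close>

lemma laplacian_eq:
  assumes X: "tangent_frame r U X" and U: "U \<subseteq> M1_domain I" "p \<in> U"
    and L: "has_laplacian \<phi> p L"
  shows "laplacian r X \<phi> p = L"
proof -
  obtain V \<phi>s \<phi>t \<phi>ss \<phi>st \<phi>ts \<phi>tt where V: "open V" "p \<in> V"
    and \<phi>: "\<And>q. q \<in> V \<Longrightarrow> has_partials \<phi> q (\<phi>s q) (\<phi>t q)"
    and \<phi>s: "has_partials \<phi>s p \<phi>ss \<phi>st" and \<phi>t: "has_partials \<phi>t p \<phi>ts \<phi>tt"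
    and L_eq: "L = - ((1 / E (p$1)) *\<^sub>R (\<phi>ss - (deriv E (p$1) / (2 * E (p$1))) *\<^sub>R \<phi>s p)
          + (1 / G (p$1)) *\<^sub>R (\<phi>tt + (deriv G (p$1) / (2 * E (p$1))) *\<^sub>R \<phi>s p))"
    using L unfolding has_laplacian_def by metis
  have p: "p \<in> M1_domain I" using U by blast
  then have s: "p$1 \<in> I" by (simp add: M1_domain_def)
  define \<epsilon> where "\<epsilon> i = frame_sign r (X i) p" for i
  define x where "x i = X i p $ 1" for i
  define z where "z i = X i p $ 2" for i
  have \<epsilon>_eq: "\<epsilon> i = E (p$1) * (x i)\<^sup>2 + G (p$1) * (z i)\<^sup>2" for i
    unfolding \<epsilon>_def frame_sign_def push_r[OF p] E42_inner_tangent x_def z_def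
    by (simp add: power2_eq_square)
  have "\<bar>\<epsilon> i\<bar> = 1" for i
    using X U unfolding tangent_frame_def \<epsilon>_def frame_sign_def by blast
  moreover have "E42_inner (push r (X 1) p) (push r (X 2) p) = 0"
    using X U unfolding tangent_frame_def by blast
  then have "E (p$1) * x 1 * x 2 + G (p$1) * z 1 * z 2 = 0"
    unfolding push_r[OF p] E42_inner_tangent x_def z_def .
  ultimately have frame:
    "\<epsilon> 1 * (x 1)\<^sup>2 + \<epsilon> 2 * (x 2)\<^sup>2 = 1 / E (p$1)"
    "\<epsilon> 1 * (z 1)\<^sup>2 + \<epsilon> 2 * (z 2)\<^sup>2 = 1 / G (p$1)"
    "\<epsilon> 1 * x 1 * z 1 + \<epsilon> 2 * x 2 * z 2 = 0"
    using pseudo_orthonormal_frame_2[OF \<epsilon>_eq[symmetric] \<epsilon>_eq[symmetric], of 1 2]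
      E_nz[OF s] G_nz[OF s] by blast+
  define T where "T i = dir_deriv (levi_civita r (X i) (X i)) \<phi> p - dir_deriv (X i) (dir_deriv (X i) \<phi>) p"
    for i
  \<comment> \<open>The derivatives \<open>X'\<close> of the frame components occur in both terms of
    \<open>T\<close> and cancel; what remains is quadratic in \<open>x i\<close>,
    \<open>z i\<close>.\<close>
  have T_eq: "T i = - ((x i)\<^sup>2 *\<^sub>R (\<phi>ss - (deriv E (p$1) / (2 * E (p$1))) *\<^sub>R \<phi>s p)
      + (z i)\<^sup>2 *\<^sub>R (\<phi>tt + (deriv G (p$1) / (2 * E (p$1))) *\<^sub>R \<phi>s p)
      + (x i * z i) *\<^sub>R (\<phi>st + \<phi>ts - (deriv G (p$1) / G (p$1)) *\<^sub>R \<phi>t p))" for i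
  proof -
    have "X i differentiable (at p)"
      using X U(2) smooth_on_differentiable unfolding tangent_frame_def by blast
    then obtain X' where X': "(X i has_derivative X') (at p)"
      by (auto simp: differentiable_def)
    have "((\<lambda>q. X i q $ 1 *\<^sub>R \<phi>s q + X i q $ 2 *\<^sub>R \<phi>t q) has_derivative
        (\<lambda>h. (x i *\<^sub>R (h$1 *\<^sub>R \<phi>ss + h$2 *\<^sub>R \<phi>st) + (X' h $ 1) *\<^sub>R \<phi>s p)
          + (z i *\<^sub>R (h$1 *\<^sub>R \<phi>ts + h$2 *\<^sub>R \<phi>tt) + (X' h $ 2) *\<^sub>R \<phi>t p))) (at p)"
      using \<phi>s \<phi>t unfolding has_partials_def x_def z_def
      by (intro has_derivative_add has_derivative_scaleR has_derivative_vec_nth X')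
    then have "(dir_deriv (X i) \<phi> has_derivative
        (\<lambda>h. (x i *\<^sub>R (h$1 *\<^sub>R \<phi>ss + h$2 *\<^sub>R \<phi>st) + (X' h $ 1) *\<^sub>R \<phi>s p)
          + (z i *\<^sub>R (h$1 *\<^sub>R \<phi>ts + h$2 *\<^sub>R \<phi>tt) + (X' h $ 2) *\<^sub>R \<phi>t p))) (at p)"
      by (rule has_derivative_transform_within_open[OF _ V])
        (simp add: has_partials_dir_deriv[OF \<phi>])
    from fun_cong[OF frechet_derivative_at[OF this], of "X i p", symmetric]
    have 1: "dir_deriv (X i) (dir_deriv (X i) \<phi>) p =
        (x i *\<^sub>R (x i *\<^sub>R \<phi>ss + z i *\<^sub>R \<phi>st) + (X' (X i p) $ 1) *\<^sub>R \<phi>s p)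
          + (z i *\<^sub>R (x i *\<^sub>R \<phi>ts + z i *\<^sub>R \<phi>tt) + (X' (X i p) $ 2) *\<^sub>R \<phi>t p)"
      unfolding x_def z_def dir_deriv_def[of "X i" "dir_deriv (X i) \<phi>"] by simp
    have "dir_deriv (X i) (X i) p = X' (X i p)"
      unfolding dir_deriv_def using frechet_derivative_at[OF X'] by simp
    then have "levi_civita r (X i) (X i) p $ 1 = X' (X i p) $ 1
        + (deriv E (p$1) / (2 * E (p$1)) * (x i)\<^sup>2 - deriv G (p$1) / (2 * E (p$1)) * (z i)\<^sup>2)"
      "levi_civita r (X i) (X i) p $ 2 = X' (X i p) $ 2 + deriv G (p$1) / G (p$1) * (x i * z i)"
      unfolding levi_civita_def x_def z_def
      by (simp_all add: sum_2 christoffel_r[OF p] power2_eq_square)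
    then have 2: "dir_deriv (levi_civita r (X i) (X i)) \<phi> p =
        (X' (X i p) $ 1 + (deriv E (p$1) / (2 * E (p$1)) * (x i)\<^sup>2
          - deriv G (p$1) / (2 * E (p$1)) * (z i)\<^sup>2)) *\<^sub>R \<phi>s p
        + (X' (X i p) $ 2 + deriv G (p$1) / G (p$1) * (x i * z i)) *\<^sub>R \<phi>t p"
      by (simp add: has_partials_dir_deriv[OF \<phi>[OF V(2)]])
    show ?thesis
      unfolding T_def 1 2 by (simp add: algebra_simps power2_eq_square)
  qed
  have combine: "e *\<^sub>R - (a *\<^sub>R A + c *\<^sub>R B + d *\<^sub>R C) + e' *\<^sub>R - (a' *\<^sub>R A + c' *\<^sub>R B + d' *\<^sub>R C) =
      - ((e * a + e' * a') *\<^sub>R A + (e * c + e' * c') *\<^sub>R B + (e * d + e' * d') *\<^sub>R C)"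
    for e e' a a' c c' d d' :: real and A B C :: 'a
    by (simp add: algebra_simps)
  have "laplacian r X \<phi> p = \<epsilon> 1 *\<^sub>R T 1 + \<epsilon> 2 *\<^sub>R T 2"
    by (simp add: laplacian_def sum_2 \<epsilon>_def T_def)
  also have "\<dots> = - ((\<epsilon> 1 * (x 1)\<^sup>2 + \<epsilon> 2 * (x 2)\<^sup>2) *\<^sub>R (\<phi>ss - (deriv E (p$1) / (2 * E (p$1))) *\<^sub>R \<phi>s p)
      + (\<epsilon> 1 * (z 1)\<^sup>2 + \<epsilon> 2 * (z 2)\<^sup>2) *\<^sub>R (\<phi>tt + (deriv G (p$1) / (2 * E (p$1))) *\<^sub>R \<phi>s p)
      + (\<epsilon> 1 * x 1 * z 1 + \<epsilon> 2 * x 2 * z 2) *\<^sub>R (\<phi>st + \<phi>ts - (deriv G (p$1) / G (p$1)) *\<^sub>R \<phi>t p))"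
    (is "_ = - (_ *\<^sub>R ?A + _ *\<^sub>R ?B + _ *\<^sub>R ?C)")
    unfolding T_eq combine mult.assoc ..
  also have "\<dots> = L"
    unfolding frame L_eq by simp
  finally show ?thesis .
qed

end

text \<open>Intermediate value theorem: a connected image containing values of both signs would
  contain 0.\<close>

lemma sgn_constant_on_interval:
  fixes f :: "real \<Rightarrow> real"
  assumes "is_interval I" "continuous_on I f" "\<And>s. s \<in> I \<Longrightarrow> f s \<noteq> 0" "s \<in> I" "t \<in> I"
  shows "sgn (f s) = sgn (f t)"
proof (rule ccontr)
  assume neq: "sgn (f s) \<noteq> sgn (f t)"
  have "is_interval (f ` I)"
    using assms(1,2) by (simp add: is_interval_connected_1 connected_continuous_image)
  moreover have "f s < 0 \<and> 0 < f t \<or> f t < 0 \<and> 0 < f s"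
    using neq assms(3-5) by (auto simp: sgn_if split: if_splits) (metis linorder_neqE)+
  ultimately have "0 \<in> f ` I"
    using assms(4,5) mem_is_interval_1_I[of "f ` I" "f s" "f t" 0]
      mem_is_interval_1_I[of "f ` I" "f t" "f s" 0] by force
  then show False using assms(3) by auto
qed

section \<open>Rules for the coordinate Laplacian, and the unit tangent frame\<close>

context rotational_surface
begin

lemma has_laplacian_add:
  assumes "has_laplacian \<phi> p L" "has_laplacian \<psi> p M"
  shows "has_laplacian (\<lambda>q. \<phi> q + \<psi> q) p (L + M)"
proof -
  obtain U \<phi>s \<phi>t \<phi>ss \<phi>st \<phi>ts \<phi>tt where 1: "open U" "p \<in> U"
    "\<And>q. q \<in> U \<Longrightarrow> has_partials \<phi> q (\<phi>s q) (\<phi>t q)"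
    "has_partials \<phi>s p \<phi>ss \<phi>st" "has_partials \<phi>t p \<phi>ts \<phi>tt"
    "L = - ((1 / E (p$1)) *\<^sub>R (\<phi>ss - (deriv E (p$1) / (2 * E (p$1))) *\<^sub>R \<phi>s p)
          + (1 / G (p$1)) *\<^sub>R (\<phi>tt + (deriv G (p$1) / (2 * E (p$1))) *\<^sub>R \<phi>s p))"
    using assms(1) unfolding has_laplacian_def by metis
  obtain V \<psi>s \<psi>t \<psi>ss \<psi>st \<psi>ts \<psi>tt where 2: "open V" "p \<in> V"
    "\<And>q. q \<in> V \<Longrightarrow> has_partials \<psi> q (\<psi>s q) (\<psi>t q)"
    "has_partials \<psi>s p \<psi>ss \<psi>st" "has_partials \<psi>t p \<psi>ts \<psi>tt"
    "M = - ((1 / E (p$1)) *\<^sub>R (\<psi>ss - (deriv E (p$1) / (2 * E (p$1))) *\<^sub>R \<psi>s p)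
          + (1 / G (p$1)) *\<^sub>R (\<psi>tt + (deriv G (p$1) / (2 * E (p$1))) *\<^sub>R \<psi>s p))"
    using assms(2) unfolding has_laplacian_def by metis
  show ?thesis
    unfolding has_laplacian_def
  proof (intro exI conjI ballI)
    show "open (U \<inter> V)" "p \<in> U \<inter> V" using 1 2 by auto
    show "has_partials (\<lambda>q. \<phi> q + \<psi> q) q (\<phi>s q + \<psi>s q) (\<phi>t q + \<psi>t q)" if "q \<in> U \<inter> V" for q
      using that by (intro has_partials_add 1 2) auto
    show "has_partials (\<lambda>q. \<phi>s q + \<psi>s q) p (\<phi>ss + \<psi>ss) (\<phi>st + \<psi>st)"
      "has_partials (\<lambda>q. \<phi>t q + \<psi>t q) p (\<phi>ts + \<psi>ts) (\<phi>tt + \<psi>tt)"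
      by (intro has_partials_add 1 2)+
    show "L + M = - ((1 / E (p$1)) *\<^sub>R ((\<phi>ss + \<psi>ss) - (deriv E (p$1) / (2 * E (p$1))) *\<^sub>R (\<phi>s p + \<psi>s p))
        + (1 / G (p$1)) *\<^sub>R ((\<phi>tt + \<psi>tt) + (deriv G (p$1) / (2 * E (p$1))) *\<^sub>R (\<phi>s p + \<psi>s p)))"
      unfolding 1(6) 2(6) by (simp add: algebra_simps)
  qed
qed

lemma has_laplacian_scaleR:
  assumes "has_laplacian \<phi> p L"
  shows "has_laplacian (\<lambda>q. c *\<^sub>R \<phi> q) p (c *\<^sub>R L)"
proof -
  obtain U \<phi>s \<phi>t \<phi>ss \<phi>st \<phi>ts \<phi>tt where 1: "open U" "p \<in> U"
    "\<And>q. q \<in> U \<Longrightarrow> has_partials \<phi> q (\<phi>s q) (\<phi>t q)"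
    "has_partials \<phi>s p \<phi>ss \<phi>st" "has_partials \<phi>t p \<phi>ts \<phi>tt"
    "L = - ((1 / E (p$1)) *\<^sub>R (\<phi>ss - (deriv E (p$1) / (2 * E (p$1))) *\<^sub>R \<phi>s p)
          + (1 / G (p$1)) *\<^sub>R (\<phi>tt + (deriv G (p$1) / (2 * E (p$1))) *\<^sub>R \<phi>s p))"
    using assms(1) unfolding has_laplacian_def by metis
  have scale: "has_partials (\<lambda>q. c *\<^sub>R \<psi> q) q (c *\<^sub>R a) (c *\<^sub>R d)" if "has_partials \<psi> q a d"
    for \<psi> :: "real^2 \<Rightarrow> 'a" and q a d
    using has_derivative_scaleR_right[OF that[unfolded has_partials_def], of c]
    unfolding has_partials_def by (simp add: algebra_simps)
  show ?thesis
    unfolding has_laplacian_def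
  proof (intro exI conjI ballI)
    show "open U" "p \<in> U" using 1 by auto
    show "has_partials (\<lambda>q. c *\<^sub>R \<phi> q) q (c *\<^sub>R \<phi>s q) (c *\<^sub>R \<phi>t q)" if "q \<in> U" for q
      using that by (intro scale 1)
    show "has_partials (\<lambda>q. c *\<^sub>R \<phi>s q) p (c *\<^sub>R \<phi>ss) (c *\<^sub>R \<phi>st)"
      "has_partials (\<lambda>q. c *\<^sub>R \<phi>t q) p (c *\<^sub>R \<phi>ts) (c *\<^sub>R \<phi>tt)"
      by (intro scale 1)+
    show "c *\<^sub>R L = - ((1 / E (p$1)) *\<^sub>R (c *\<^sub>R \<phi>ss - (deriv E (p$1) / (2 * E (p$1))) *\<^sub>R (c *\<^sub>R \<phi>s p))
        + (1 / G (p$1)) *\<^sub>R (c *\<^sub>R \<phi>tt + (deriv G (p$1) / (2 * E (p$1))) *\<^sub>R (c *\<^sub>R \<phi>s p)))"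
      unfolding 1(6) by (simp add: algebra_simps)
  qed
qed

lemma has_laplacian_cong:
  assumes "has_laplacian \<phi> p L" and V: "open V" "p \<in> V" and eq: "\<And>q. q \<in> V \<Longrightarrow> \<phi> q = \<psi> q"
  shows "has_laplacian \<psi> p L"
proof -
  obtain U \<phi>s \<phi>t \<phi>ss \<phi>st \<phi>ts \<phi>tt where 1: "open U" "p \<in> U"
    "\<And>q. q \<in> U \<Longrightarrow> has_partials \<phi> q (\<phi>s q) (\<phi>t q)"
    "has_partials \<phi>s p \<phi>ss \<phi>st" "has_partials \<phi>t p \<phi>ts \<phi>tt"
    "L = - ((1 / E (p$1)) *\<^sub>R (\<phi>ss - (deriv E (p$1) / (2 * E (p$1))) *\<^sub>R \<phi>s p)
          + (1 / G (p$1)) *\<^sub>R (\<phi>tt + (deriv G (p$1) / (2 * E (p$1))) *\<^sub>R \<phi>s p))"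
    using assms(1) unfolding has_laplacian_def by metis
  show ?thesis
    unfolding has_laplacian_def
  proof (intro exI conjI ballI)
    show "open (U \<inter> V)" "p \<in> U \<inter> V" using 1 V by auto
    show "has_partials \<psi> q (\<phi>s q) (\<phi>t q)" if "q \<in> U \<inter> V" for q
      using that by (intro has_partials_cong[OF 1(3) V(1) _ eq]) auto
  qed (rule 1)+
qed

lemma has_laplacian_separated:
  fixes f g f' g' :: "real \<Rightarrow> real"
  assumes p: "p \<in> M1_domain I"
    and f: "\<And>s. s \<in> I \<Longrightarrow> (f has_real_derivative f' s) (at s)" "(f' has_real_derivative f'') (at (p$1))"
    and g: "\<And>t. (g has_real_derivative g' t) (at t)" "(g' has_real_derivative g'') (at (p$2))"
  defines "s \<equiv> p$1" and "t \<equiv> p$2"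
  shows "has_laplacian (\<lambda>q. (f (q$1) * g (q$2)) *\<^sub>R v) p
    (- ((f'' - deriv E s / (2 * E s) * f' s + deriv G s / (2 * G s) * f' s) * g t / E s
        + f s * g'' / G s) *\<^sub>R v)"
  unfolding has_laplacian_def
proof (intro exI conjI ballI)
  show "open (M1_domain I)" "p \<in> M1_domain I" by (rule open_M1_domain[OF open_I]) (rule p)
  show "has_partials (\<lambda>q. (f (q$1) * g (q$2)) *\<^sub>R v) q ((f' (q$1) * g (q$2)) *\<^sub>R v) ((f (q$1) * g' (q$2)) *\<^sub>R v)"
    if "q \<in> M1_domain I" for q
    using that by (intro has_partials_separated f g) (simp add: M1_domain_def)
  have s: "p$1 \<in> I" using p by (simp add: M1_domain_def)
  show "has_partials (\<lambda>q. (f' (q$1) * g (q$2)) *\<^sub>R v) p ((f'' * g (p$2)) *\<^sub>R v) ((f' (p$1) * g' (p$2)) *\<^sub>R v)"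
    "has_partials (\<lambda>q. (f (q$1) * g' (q$2)) *\<^sub>R v) p ((f' (p$1) * g' (p$2)) *\<^sub>R v) ((f (p$1) * g'') *\<^sub>R v)"
    by (intro has_partials_separated f g s)+
  have nz: "E s \<noteq> 0" "G s \<noteq> 0" using E_nz G_nz s by (auto simp: s_def)
  have coeff: "- ((f'' - deriv E s / (2 * E s) * f' s + deriv G s / (2 * G s) * f' s) * g t / E s + f s * g'' / G s) =
    - ((1 / E s) * (f'' * g t - (deriv E s / (2 * E s)) * (f' s * g t))
      + (1 / G s) * (f s * g'' + (deriv G s / (2 * E s)) * (f' s * g t)))"
    using nz by (simp add: field_simps)
  show "- ((f'' - deriv E s / (2 * E s) * f' s + deriv G s / (2 * G s) * f' s) * g t / E s + f s * g'' / G s) *\<^sub>R v =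
    - ((1 / E (p$1)) *\<^sub>R ((f'' * g (p$2)) *\<^sub>R v - (deriv E (p$1) / (2 * E (p$1))) *\<^sub>R ((f' (p$1) * g (p$2)) *\<^sub>R v))
      + (1 / G (p$1)) *\<^sub>R ((f (p$1) * g'') *\<^sub>R v + (deriv G (p$1) / (2 * E (p$1))) *\<^sub>R ((f' (p$1) * g (p$2)) *\<^sub>R v)))"
    unfolding coeff unfolding s_def t_def
    by (simp only: scaleR_scaleR scaleR_minus_left scaleR_left_distrib scaleR_left_diff_distrib
        scaleR_right_distrib scaleR_right_diff_distrib distrib_left right_diff_distrib mult.assoc)
qed

text \<open>With \<open>c = 0\<close> the first rule also covers functions of s alone, the cosh
  factor being 1.\<close>

lemma has_laplacian_cosh_sinh:
  fixes f f' :: "real \<Rightarrow> real" and v :: "'b::real_normed_vector"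
  assumes p: "p \<in> M1_domain I"
    and f: "\<And>s. s \<in> I \<Longrightarrow> (f has_real_derivative f' s) (at s)" "(f' has_real_derivative f'') (at (p$1))"
  shows "has_laplacian (\<lambda>q. (f (q$1) * cosh (c * q$2)) *\<^sub>R v) p
    (- ((f'' - deriv E (p$1) / (2 * E (p$1)) * f' (p$1) + deriv G (p$1) / (2 * G (p$1)) * f' (p$1))
        * cosh (c * p$2) / E (p$1) + f (p$1) * (c\<^sup>2 * cosh (c * p$2)) / G (p$1)) *\<^sub>R v)"
    "has_laplacian (\<lambda>q. (f (q$1) * sinh (c * q$2)) *\<^sub>R v) p
    (- ((f'' - deriv E (p$1) / (2 * E (p$1)) * f' (p$1) + deriv G (p$1) / (2 * G (p$1)) * f' (p$1))
        * sinh (c * p$2) / E (p$1) + f (p$1) * (c\<^sup>2 * sinh (c * p$2)) / G (p$1)) *\<^sub>R v)"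
proof -
  have d: "((\<lambda>t. cosh (c * t)) has_real_derivative c * sinh (c * t)) (at t)"
    "((\<lambda>t. sinh (c * t)) has_real_derivative c * cosh (c * t)) (at t)"
    "((\<lambda>t. c * cosh (c * t)) has_real_derivative c\<^sup>2 * sinh (c * t)) (at t)"
    "((\<lambda>t. c * sinh (c * t)) has_real_derivative c\<^sup>2 * cosh (c * t)) (at t)" for t
    by (auto intro!: derivative_eq_intros simp: power2_eq_square)
  show "has_laplacian (\<lambda>q. (f (q$1) * cosh (c * q$2)) *\<^sub>R v) p
    (- ((f'' - deriv E (p$1) / (2 * E (p$1)) * f' (p$1) + deriv G (p$1) / (2 * G (p$1)) * f' (p$1))
        * cosh (c * p$2) / E (p$1) + f (p$1) * (c\<^sup>2 * cosh (c * p$2)) / G (p$1)) *\<^sub>R v)"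
    by (rule has_laplacian_separated[OF p f d(1) d(4)])
  show "has_laplacian (\<lambda>q. (f (q$1) * sinh (c * q$2)) *\<^sub>R v) p
    (- ((f'' - deriv E (p$1) / (2 * E (p$1)) * f' (p$1) + deriv G (p$1) / (2 * G (p$1)) * f' (p$1))
        * sinh (c * p$2) / E (p$1) + f (p$1) * (c\<^sup>2 * sinh (c * p$2)) / G (p$1)) *\<^sub>R v)"
    by (rule has_laplacian_separated[OF p f d(2) d(3)])
qed

text \<open>Beltrami's formula. \<open>push r X\<close> is X applied to r, so with the sign
  convention of \<open>laplacian\<close> each summand is minus the corresponding value of the second
  fundamental form.\<close>

lemma mean_curvature_eq_laplacian: "mean_curvature r X p = - (1/2) *\<^sub>R laplacian r X r p"
  unfolding mean_curvature_def laplacian_def second_fund_form_def push_eq_dir_deriv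
  by (simp add: sum_2 algebra_simps)

text \<open>Read off at an arbitrarily chosen parameter so that the signs are constants;
  connectedness of I makes the choice immaterial.\<close>

definition \<epsilon>s :: real where "\<epsilon>s = sgn (E (SOME s. s \<in> I))"
definition \<epsilon>t :: real where "\<epsilon>t = sgn (G (SOME s. s \<in> I))"

lemma sgn_E: "s \<in> I \<Longrightarrow> sgn (E s) = \<epsilon>s" and sgn_G: "s \<in> I \<Longrightarrow> sgn (G s) = \<epsilon>t"
  unfolding \<epsilon>s_def \<epsilon>t_def
  by (rule sgn_constant_on_interval[OF interval_I]; use nonempty_I smooth_E smooth_G in
      \<open>auto simp: E_nz G_nz some_in_eq smooth_on_imp_continuous_on\<close>)+

lemma \<epsilon>_sq [simp]: "\<epsilon>s * \<epsilon>s = 1" "\<epsilon>t * \<epsilon>t = 1" "\<bar>\<epsilon>s\<bar> = 1" "\<bar>\<epsilon>t\<bar> = 1"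
proof -
  obtain s where s: "s \<in> I" using nonempty_I by auto
  show "\<epsilon>s * \<epsilon>s = 1" "\<epsilon>t * \<epsilon>t = 1" "\<bar>\<epsilon>s\<bar> = 1" "\<bar>\<epsilon>t\<bar> = 1"
    unfolding sgn_E[OF s, symmetric] sgn_G[OF s, symmetric]
    using E_nz[OF s] G_nz[OF s] by (simp_all add: sgn_if)
qed

lemma \<epsilon>E_pos: "s \<in> I \<Longrightarrow> \<epsilon>s * E s > 0" and \<epsilon>G_pos: "s \<in> I \<Longrightarrow> \<epsilon>t * G s > 0"
  using E_nz G_nz by (auto simp flip: sgn_E sgn_G simp: sgn_if linorder_neq_iff)

text \<open>Lengths of the coordinate fields. A constant sign factor instead of an absolute value
  keeps the radicand visibly smooth.\<close>

definition len_s :: "real \<Rightarrow> real" where "len_s s = sqrt (\<epsilon>s * E s)"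
definition len_t :: "real \<Rightarrow> real" where "len_t s = sqrt (\<epsilon>t * G s)"

lemma len_pos: "s \<in> I \<Longrightarrow> len_s s > 0" "s \<in> I \<Longrightarrow> len_t s > 0"
  by (simp_all add: len_s_def len_t_def \<epsilon>E_pos \<epsilon>G_pos)

lemma len_sq: "s \<in> I \<Longrightarrow> (len_s s)\<^sup>2 = \<epsilon>s * E s" "s \<in> I \<Longrightarrow> (len_t s)\<^sup>2 = \<epsilon>t * G s"
  using \<epsilon>E_pos \<epsilon>G_pos by (simp_all add: len_s_def len_t_def less_imp_le)

lemma smooth_len: "smooth_on I len_s" "smooth_on I len_t"
  unfolding len_s_def[abs_def] len_t_def[abs_def]
  by (intro smooth_on_sqrt smooth_on_mult smooth_on_const smooth_E smooth_G open_I \<epsilon>E_pos \<epsilon>G_pos; assumption)+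

lemma DERIV_len:
  assumes "s \<in> I"
  shows "(len_s has_real_derivative \<epsilon>s * deriv E s / (2 * len_s s)) (at s)"
    "(len_t has_real_derivative \<epsilon>t * deriv G s / (2 * len_t s)) (at s)"
  unfolding len_s_def[abs_def] len_t_def[abs_def]
  by (use \<epsilon>E_pos[OF assms] \<epsilon>G_pos[OF assms] in
      \<open>auto intro!: derivative_eq_intros DERIV_E DERIV_G assms simp: field_simps\<close>)

lemma deriv_E:
  assumes "s \<in> I"
  shows "deriv E s = 2 * (deriv y s * deriv (deriv y) s - deriv w s * deriv (deriv w) s)"
  by (rule DERIV_imp_deriv, unfold E_def[abs_def])
    (auto intro!: derivative_eq_intros DERIV_profile assms)

lemma deriv_G:
  assumes "s \<in> I"
  shows "deriv G s = 2 * (w s * deriv w s - b\<^sup>2 * y s * deriv y s)"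
  by (rule DERIV_imp_deriv, unfold G_def[abs_def])
    (auto intro!: derivative_eq_intros DERIV_profile assms)

definition unit_frame :: "2 \<Rightarrow> real^2 \<Rightarrow> real^2" where
  "unit_frame i p = (if i = 1 then 1 / len_s (p$1) else 1 / len_t (p$1)) *\<^sub>R axis i 1"

lemma unit_frame_12:
  "unit_frame 1 = (\<lambda>p. (1 / len_s (p$1)) *\<^sub>R axis 1 1)"
  "unit_frame 2 = (\<lambda>p. (1 / len_t (p$1)) *\<^sub>R axis 2 1)"
  by (simp_all add: unit_frame_def fun_eq_iff)

lemma push_unit_frame:
  assumes "q \<in> M1_domain I"
  shows "push r (unit_frame 1) q = (1 / len_s (q$1)) *\<^sub>R rs q"
    "push r (unit_frame 2) q = (1 / len_t (q$1)) *\<^sub>R rt q"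
  by (simp_all add: push_r[OF assms] unit_frame_12 axis_def)

lemma smooth_unit_frame: "smooth_on (M1_domain I) (unit_frame i)"
proof -
  have "smooth_on (M1_domain I) (\<lambda>p. (1 / len_s (p$1)) *\<^sub>R (axis 1 1 :: real^2))"
    "smooth_on (M1_domain I) (\<lambda>p. (1 / len_t (p$1)) *\<^sub>R (axis 2 1 :: real^2))"
    by (intro smooth_on_scaleR smooth_on_divide smooth_on_const open_M1_domain open_I
        smooth_on_fst_component smooth_len; use len_pos in \<open>force simp: M1_domain_def\<close>)+
  then show ?thesis
    using exhaust_2[of i] unfolding unit_frame_12[symmetric] by auto
qed

lemma tangent_unit_frame: "tangent_frame r (M1_domain I) unit_frame"
proof -
  have "\<bar>E42_inner (push r (unit_frame i) q) (push r (unit_frame i) q)\<bar> = 1 \<and>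
      E42_inner (push r (unit_frame 1) q) (push r (unit_frame 2) q) = 0"
    if q: "q \<in> M1_domain I" for i q
  proof -
    have s: "q$1 \<in> I" using q by (simp add: M1_domain_def)
    have "E (q$1) / (len_s (q$1))\<^sup>2 = \<epsilon>s" "G (q$1) / (len_t (q$1))\<^sup>2 = \<epsilon>t"
      using E_nz[OF s] G_nz[OF s] \<epsilon>_sq by (auto simp: len_sq[OF s] field_simps simp del: \<epsilon>_sq)
    then have "E42_inner (push r (unit_frame 1) q) (push r (unit_frame 1) q) = \<epsilon>s"
      "E42_inner (push r (unit_frame 2) q) (push r (unit_frame 2) q) = \<epsilon>t"
      "E42_inner (push r (unit_frame 1) q) (push r (unit_frame 2) q) = 0"
      unfolding push_unit_frame[OF q]
      using E42_inner_tangent[of "1 / len_s (q$1)" q 0 "1 / len_s (q$1)" 0]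
        E42_inner_tangent[of 0 q "1 / len_t (q$1)" 0 "1 / len_t (q$1)"]
        E42_inner_tangent[of "1 / len_s (q$1)" q 0 0 "1 / len_t (q$1)"]
      by (simp_all add: power2_eq_square)
    then show ?thesis using exhaust_2[of i] by auto
  qed
  then show ?thesis
    unfolding tangent_frame_def using smooth_unit_frame open_M1_domain[OF open_I] by blast
qed

end

section \<open>The differential equation of the profile curve\<close>

locale minimal_rotational_surface = rotational_surface +
  assumes zero_mean: "zero_mean_curvature r (M1_domain I)"
begin

text \<open>The component of \<Delta>r = 0 along a normal direction: of the equations for the y and
  w components, the first times w' minus the second times y' is free of E' and G'.\<close>

lemma profile_ode:
  assumes s: "s \<in> I"
  shows "(deriv (deriv y) s * deriv w s - deriv (deriv w) s * deriv y s) * G s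
    + (b\<^sup>2 * y s * deriv w s - w s * deriv y s) * E s = 0"
proof -
  \<comment> \<open>At t = 0 the sinh terms vanish, so component 4 sees only w and component 2 only
    y.\<close>
  define p :: "real^2" where "p = vector [s, 0]"
  have p12 [simp]: "p$1 = s" "p$2 = 0" by (simp_all add: p_def)
  have p: "p \<in> M1_domain I" using s by (simp add: M1_domain_def)
  let ?D = "\<lambda>f' f''. f'' - deriv E s / (2 * E s) * f' + deriv G s / (2 * G s) * f'"
  note sep = has_laplacian_cosh_sinh[OF p, unfolded p12]
  have "has_laplacian (\<lambda>q. (w (q$1) * sinh (1 * q$2)) *\<^sub>R axis 1 1 + (w (q$1) * cosh (1 * q$2)) *\<^sub>R axis 4 1
    + (y (q$1) * cosh (b * q$2)) *\<^sub>R axis 2 1 + (y (q$1) * sinh (b * q$2)) *\<^sub>R axis 3 1 :: real^4) p (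
      (- (?D (deriv w s) (deriv (deriv w) s) * sinh (1 * 0) / E s + w s * (1\<^sup>2 * sinh (1 * 0)) / G s)) *\<^sub>R axis 1 1
    + (- (?D (deriv w s) (deriv (deriv w) s) * cosh (1 * 0) / E s + w s * (1\<^sup>2 * cosh (1 * 0)) / G s)) *\<^sub>R axis 4 1
    + (- (?D (deriv y s) (deriv (deriv y) s) * cosh (b * 0) / E s + y s * (b\<^sup>2 * cosh (b * 0)) / G s)) *\<^sub>R axis 2 1
    + (- (?D (deriv y s) (deriv (deriv y) s) * sinh (b * 0) / E s + y s * (b\<^sup>2 * sinh (b * 0)) / G s)) *\<^sub>R axis 3 1)"
    (is "has_laplacian _ p ?L")
    by (intro has_laplacian_add sep DERIV_profile s)
  then have "has_laplacian r p ?L"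
    unfolding M1_separated by simp
  from laplacian_eq[OF tangent_unit_frame _ p this]
  have L: "laplacian r unit_frame r p = ?L" by simp
  have "mean_curvature r unit_frame p = 0"
    using zero_mean tangent_unit_frame p unfolding zero_mean_curvature_def by blast
  then have "?L $ 4 = 0" "?L $ 2 = 0"
    unfolding mean_curvature_eq_laplacian L by auto
  then have "?D (deriv w s) (deriv (deriv w) s) / E s + w s / G s = 0"
    "?D (deriv y s) (deriv (deriv y) s) / E s + y s * b\<^sup>2 / G s = 0"
    by (simp_all add: axis_def)
  then have *: "?D (deriv w s) (deriv (deriv w) s) * G s + w s * E s = 0"
    "?D (deriv y s) (deriv (deriv y) s) * G s + y s * b\<^sup>2 * E s = 0"
    using E_nz[OF s] G_nz[OF s] by (simp_all add: divide_add_eq_iff add_divide_eq_iff)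
  have "(deriv (deriv y) s * deriv w s - deriv (deriv w) s * deriv y s) * G s
    + (b\<^sup>2 * y s * deriv w s - w s * deriv y s) * E s =
    (?D (deriv y s) (deriv (deriv y) s) * G s + y s * b\<^sup>2 * E s) * deriv w s
    - (?D (deriv w s) (deriv (deriv w) s) * G s + w s * E s) * deriv y s"
    by (simp add: algebra_simps)
  then show ?thesis unfolding * by simp
qed

end

section \<open>Split-complex coordinates of the two parts of the Gauss map\<close>

context rotational_surface
begin

lemma divide_\<epsilon>: "x / \<epsilon>s = x * \<epsilon>s" "x / \<epsilon>t = x * \<epsilon>t"
proof -
  have "\<epsilon>s \<noteq> 0" "\<epsilon>t \<noteq> 0" using \<epsilon>_sq(3,4) abs_zero zero_neq_one by metis+
  then show "x / \<epsilon>s = x * \<epsilon>s" "x / \<epsilon>t = x * \<epsilon>t"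
    by (simp_all add: nonzero_divide_eq_eq mult.assoc)
qed

text \<open>The velocity of the profile curve with respect to arc length.\<close>

definition y1 :: "real \<Rightarrow> real" where "y1 s = deriv y s / len_s s"
definition w1 :: "real \<Rightarrow> real" where "w1 s = deriv w s / len_s s"

text \<open>Here \<beta> will be b or -b. With j^2 = 1, \<open>xc\<close> + j \<open>zc\<close> is
  (w + j \<beta> y)(w1 + j y1) / \<open>len_t\<close>; these combinations arise when the wedge of
  two normals is expanded (\<open>wedge_normals\<close>).\<close>

definition xc :: "real \<Rightarrow> real \<Rightarrow> real" where
  "xc \<beta> s = (\<beta> * y s * y1 s + w s * w1 s) / len_t s"
definition zc :: "real \<Rightarrow> real \<Rightarrow> real" where
  "zc \<beta> s = (w s * y1 s + \<beta> * y s * w1 s) / len_t s"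

lemma y1_w1_sq:
  assumes "s \<in> I"
  shows "(y1 s)\<^sup>2 - (w1 s)\<^sup>2 = \<epsilon>s"
proof -
  have "(y1 s)\<^sup>2 - (w1 s)\<^sup>2 = E s / (\<epsilon>s * E s)"
    unfolding y1_def w1_def power_divide len_sq[OF assms] diff_divide_distrib[symmetric] E_def[of s] ..
  then show ?thesis using E_nz[OF assms] divide_\<epsilon>(1)[of 1] by simp
qed

text \<open>The split-complex norm a^2 - c^2 of a + j c is multiplicative: w + j \<beta> y has norm
  G, and w1 + j y1 has norm -\<epsilon>s.\<close>

lemma xc_zc_sq:
  assumes s: "s \<in> I" and \<beta>: "\<beta>\<^sup>2 = b\<^sup>2"
  shows "(xc \<beta> s)\<^sup>2 - (zc \<beta> s)\<^sup>2 = - (\<epsilon>s * \<epsilon>t)"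
proof -
  have "(\<beta> * y s * y1 s + w s * w1 s)\<^sup>2 - (w s * y1 s + \<beta> * y s * w1 s)\<^sup>2
      = ((y1 s)\<^sup>2 - (w1 s)\<^sup>2) * (\<beta>\<^sup>2 * (y s)\<^sup>2 - (w s)\<^sup>2)"
    by (simp add: algebra_simps power2_eq_square)
  also have "\<dots> = - (\<epsilon>s * G s)"
    unfolding y1_w1_sq[OF s] \<beta> by (simp add: G_def algebra_simps)
  finally have "(xc \<beta> s)\<^sup>2 - (zc \<beta> s)\<^sup>2 = - (\<epsilon>s * G s) / (\<epsilon>t * G s)"
    by (simp add: xc_def zc_def power_divide len_sq[OF s] diff_divide_distrib[symmetric])
  also have "\<dots> = - (\<epsilon>s * \<epsilon>t)"
    using G_nz[OF s] divide_\<epsilon>(2)[of \<epsilon>s] by simp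
  finally show ?thesis .
qed

end

context minimal_rotational_surface
begin

text \<open>The unit velocity moves on the hyperbola y1^2 - w1^2 = \<epsilon>s, so its derivative is
  a multiple of (w1, y1). The multiple is a curvature, which \<open>profile_ode\<close> expresses
  without second derivatives.\<close>

lemma DERIV_y1_w1:
  assumes s: "s \<in> I"
  defines "M \<equiv> b\<^sup>2 * y s * w1 s - w s * y1 s"
  shows "(y1 has_real_derivative len_s s * w1 s * M / G s) (at s)"
    "(w1 has_real_derivative len_s s * y1 s * M / G s) (at s)"
proof -
  define y' y'' w' w'' l where "y' = deriv y s" and "y'' = deriv (deriv y) s"
    and "w' = deriv w s" and "w'' = deriv (deriv w) s" and "l = len_s s"
  note defs = y'_def[symmetric] y''_def[symmetric] w'_def[symmetric] w''_def[symmetric] l_def[symmetric]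
  have l: "l \<noteq> 0" using len_pos(1)[OF s] by (simp add: l_def)
  have l2: "l\<^sup>2 = \<epsilon>s * (y'\<^sup>2 - w'\<^sup>2)"
    using len_sq(1)[OF s] by (simp add: l_def E_def y'_def w'_def)
  have E': "\<epsilon>s * deriv E s / (2 * l) = \<epsilon>s * (y' * y'' - w' * w'') / l"
    using l by (simp add: deriv_E[OF s] y'_def y''_def w'_def w''_def field_simps)
  have lM: "l * M = b\<^sup>2 * y s * w' - w s * y'"
    using l unfolding M_def y1_def w1_def defs by (simp add: field_simps)
  have ode: "(y'' * w' - w'' * y') * G s + l * M * (\<epsilon>s * l\<^sup>2) = 0"
  proof -
    have "\<epsilon>s * l\<^sup>2 = E s"
      using len_sq(1)[OF s] by (simp add: l_def mult.assoc[symmetric])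
    then show ?thesis
      using profile_ode[OF s] unfolding lM by (simp add: y'_def y''_def w'_def w''_def)
  qed
  then have lM': "l * M / G s = - \<epsilon>s * (y'' * w' - w'' * y') / l\<^sup>2"
  proof -
    have "(l * M * l\<^sup>2) * (\<epsilon>s * \<epsilon>s) = - \<epsilon>s * (y'' * w' - w'' * y') * G s"
      using ode by algebra
    then show ?thesis using G_nz[OF s] l by (simp add: field_simps)
  qed
  have nz: "len_s s \<noteq> 0" using l by (simp add: l_def)
  have "(y1 has_real_derivative (y'' * l - y' * (\<epsilon>s * (y' * y'' - w' * w'') / l)) / (l * l)) (at s)"
    "(w1 has_real_derivative (w'' * l - w' * (\<epsilon>s * (y' * y'' - w' * w'') / l)) / (l * l)) (at s)"
    using DERIV_divide[OF DERIV_profile(3)[OF s] DERIV_len(1)[OF s] nz]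
      DERIV_divide[OF DERIV_profile(4)[OF s] DERIV_len(1)[OF s] nz]
    unfolding y1_def[abs_def] w1_def[abs_def] defs E' by simp_all
  moreover have "(y'' * l - y' * (\<epsilon>s * (y' * y'' - w' * w'') / l)) / (l * l) = w' * (l * M / G s) / l"
  proof -
    have "y'' * l\<^sup>2 - y' * (\<epsilon>s * (y' * y'' - w' * w'')) = - w' * \<epsilon>s * (y'' * w' - w'' * y')"
      unfolding l2 by algebra
    then show ?thesis unfolding lM' using l by (simp add: field_simps power2_eq_square)
  qed
  moreover have "(w'' * l - w' * (\<epsilon>s * (y' * y'' - w' * w'') / l)) / (l * l) = y' * (l * M / G s) / l"
  proof -
    have "w'' * l\<^sup>2 - w' * (\<epsilon>s * (y' * y'' - w' * w'')) = - y' * \<epsilon>s * (y'' * w' - w'' * y')"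
      unfolding l2 by algebra
    then show ?thesis unfolding lM' using l by (simp add: field_simps power2_eq_square)
  qed
  moreover have "w' * (l * M / G s) / l = len_s s * w1 s * M / G s"
    "y' * (l * M / G s) / l = len_s s * y1 s * M / G s"
    unfolding y1_def w1_def defs by simp_all
  ultimately show "(y1 has_real_derivative len_s s * w1 s * M / G s) (at s)"
    "(w1 has_real_derivative len_s s * y1 s * M / G s) (at s)"
    by simp_all
qed

text \<open>With \<open>DERIV_y1_w1\<close> inserted and denominators cleared, these are polynomial
  identities in y, w, y1, w1. The factor \<beta> - 1 arises because (w, \<beta> y) has velocity
  proportional to (w1, \<beta> y1), which matches (w1, y1) only for \<beta> = 1.\<close>

lemma DERIV_xc_zc:
  assumes s: "s \<in> I" and \<beta>: "\<beta>\<^sup>2 = b\<^sup>2"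
  shows "(xc \<beta> has_real_derivative (\<beta> - 1) * \<epsilon>t * (len_s s / len_t s) * (zc \<beta> s)\<^sup>2) (at s)"
    "(zc \<beta> has_real_derivative (\<beta> - 1) * \<epsilon>t * (len_s s / len_t s) * (xc \<beta> s * zc \<beta> s)) (at s)"
proof -
  define l q where "l = len_s s" and "q = len_t s"
  define Y W Y1 W1 where "Y = y s" and "W = w s" and "Y1 = y1 s" and "W1 = w1 s"
  define M where "M = \<beta>\<^sup>2 * Y * W1 - W * Y1"
  define g where "g = G s"
  note defs = l_def[symmetric] q_def[symmetric] Y_def[symmetric] W_def[symmetric]
    Y1_def[symmetric] W1_def[symmetric] g_def[symmetric]
  have l: "l \<noteq> 0" and q: "q \<noteq> 0" using len_pos[OF s] by (simp_all add: l_def q_def)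
  have g_nz: "g \<noteq> 0" using G_nz[OF s] by (simp add: g_def)
  have g: "g = W\<^sup>2 - \<beta>\<^sup>2 * Y\<^sup>2" by (simp add: g_def G_def \<beta> Y_def W_def)
  have q2: "q\<^sup>2 = \<epsilon>t * g" using len_sq(2)[OF s] by (simp add: q_def g_def)
  have y': "deriv y s = l * Y1" and w': "deriv w s = l * W1"
    using l by (simp_all add: Y1_def W1_def y1_def w1_def l_def)
  have G': "\<epsilon>t * deriv G s / (2 * q) = \<epsilon>t * l * (W * W1 - \<beta>\<^sup>2 * Y * Y1) / q"
    unfolding deriv_G[OF s] y' w' \<beta>[symmetric] Y_def W_def using q by (simp add: field_simps)
  note d = DERIV_profile(1,2)[OF s] DERIV_y1_w1[OF s] DERIV_len(2)[OF s]
  have nz: "len_t s \<noteq> 0" using q by (simp add: q_def)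
  define Nx Nz where "Nx = \<beta> * Y * Y1 + W * W1" and "Nz = W * Y1 + \<beta> * Y * W1"
  define Dx where "Dx = \<beta> * (l * Y1) * Y1 + \<beta> * Y * (l * W1 * M / g) + (l * W1 * W1 + W * (l * Y1 * M / g))"
  define Dz where "Dz = l * W1 * Y1 + W * (l * W1 * M / g) + (\<beta> * (l * Y1) * W1 + \<beta> * Y * (l * Y1 * M / g))"
  have num: "((\<lambda>s. \<beta> * y s * y1 s + w s * w1 s) has_real_derivative Dx) (at s)"
    "((\<lambda>s. w s * y1 s + \<beta> * y s * w1 s) has_real_derivative Dz) (at s)"
    by (auto intro!: derivative_eq_intros d simp: Dx_def Dz_def defs y' w' M_def \<beta>[symmetric] algebra_simps)
  have "(xc \<beta> has_real_derivative (Dx * q - Nx * (\<epsilon>t * l * (W * W1 - \<beta>\<^sup>2 * Y * Y1) / q)) / (q * q)) (at s)"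
    "(zc \<beta> has_real_derivative (Dz * q - Nz * (\<epsilon>t * l * (W * W1 - \<beta>\<^sup>2 * Y * Y1) / q)) / (q * q)) (at s)"
    using DERIV_divide[OF num(1) d(5) nz] DERIV_divide[OF num(2) d(5) nz]
    unfolding xc_def[abs_def] zc_def[abs_def] defs G' Nx_def[symmetric] Nz_def[symmetric] by simp_all
  moreover have "(Dx * q - Nx * (\<epsilon>t * l * (W * W1 - \<beta>\<^sup>2 * Y * Y1) / q)) / (q * q)
      = (\<beta> - 1) * \<epsilon>t * (l / q) * (Nz / q)\<^sup>2"
  proof -
    \<comment> \<open>Multiplying by \<open>g\<close> removes the quotient \<open>M / g\<close>;
      passing from \<open>g\<close> to \<open>q\<^sup>2 = \<epsilon>t * g\<close> then brings in the
      sign.\<close>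
    have "Dx * g = l * ((\<beta> * Y1\<^sup>2 + W1\<^sup>2) * g + (\<beta> * Y * W1 + W * Y1) * M)"
      using g_nz by (simp add: Dx_def field_simps power2_eq_square)
    then have "Dx * g - Nx * (l * (W * W1 - \<beta>\<^sup>2 * Y * Y1)) = (\<beta> - 1) * l * Nz\<^sup>2"
      unfolding Nx_def Nz_def M_def g by algebra
    then have "Dx * q\<^sup>2 - Nx * (\<epsilon>t * l * (W * W1 - \<beta>\<^sup>2 * Y * Y1)) = (\<beta> - 1) * \<epsilon>t * l * Nz\<^sup>2"
      unfolding q2 by algebra
    then show ?thesis using q by (simp add: field_simps power2_eq_square)
  qed
  moreover have "(Dz * q - Nz * (\<epsilon>t * l * (W * W1 - \<beta>\<^sup>2 * Y * Y1) / q)) / (q * q)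
      = (\<beta> - 1) * \<epsilon>t * (l / q) * (Nx / q * (Nz / q))"
  proof -
    have "Dz * g = l * ((\<beta> + 1) * W1 * Y1 * g + (W * W1 + \<beta> * Y * Y1) * M)"
      using g_nz by (simp add: Dz_def field_simps power2_eq_square)
    then have "Dz * g - Nz * (l * (W * W1 - \<beta>\<^sup>2 * Y * Y1)) = (\<beta> - 1) * l * (Nx * Nz)"
      unfolding Nx_def Nz_def M_def g by algebra
    then have "Dz * q\<^sup>2 - Nz * (\<epsilon>t * l * (W * W1 - \<beta>\<^sup>2 * Y * Y1)) = (\<beta> - 1) * \<epsilon>t * l * (Nx * Nz)"
      unfolding q2 by algebra
    then show ?thesis using q by (simp add: field_simps power2_eq_square)
  qed
  moreover have "xc \<beta> s = Nx / q" "zc \<beta> s = Nz / q"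
    by (simp_all add: xc_def zc_def Nx_def Nz_def Y_def W_def Y1_def W1_def q_def)
  ultimately show
    "(xc \<beta> has_real_derivative (\<beta> - 1) * \<epsilon>t * (len_s s / len_t s) * (zc \<beta> s)\<^sup>2) (at s)"
    "(zc \<beta> has_real_derivative (\<beta> - 1) * \<epsilon>t * (len_s s / len_t s) * (xc \<beta> s * zc \<beta> s)) (at s)"
    by (simp_all add: l_def q_def)
qed

end

section \<open>The self-dual and the anti-self-dual part of the Gauss map\<close>

definition e2 :: "4 \<Rightarrow> 4 \<Rightarrow> real^4^4" where "e2 i j = wedge (axis i 1) (axis j 1)"

text \<open>For \<open>\<sigma> = 1\<close> and \<open>\<sigma> = -1\<close> the following bivectors span the two eigenspaces of the Hodge star.\<close>

definition gJ :: "real \<Rightarrow> real^4^4" where "gJ \<sigma> = e2 2 3 - \<sigma> *\<^sub>R e2 1 4"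
definition gC :: "real \<Rightarrow> real^4^4" where "gC \<sigma> = - \<sigma> *\<^sub>R e2 1 2 - e2 3 4"
definition gS :: "real \<Rightarrow> real^4^4" where "gS \<sigma> = e2 1 3 + \<sigma> *\<^sub>R e2 2 4"

context rotational_surface
begin

definition gpart :: "real \<Rightarrow> real^2 \<Rightarrow> real^4^4" where
  "gpart \<sigma> p = xc (\<sigma> * b) (p$1) *\<^sub>R gJ \<sigma>
    + (zc (\<sigma> * b) (p$1) * cosh ((1 - \<sigma> * b) * p$2)) *\<^sub>R gC \<sigma>
    + (zc (\<sigma> * b) (p$1) * sinh ((1 - \<sigma> * b) * p$2)) *\<^sub>R gS \<sigma>"

definition \<kappa> :: "real \<Rightarrow> real \<Rightarrow> real" where
  "\<kappa> \<sigma> s = - 2 * (1 - \<sigma> * b)\<^sup>2 * (zc (\<sigma> * b) s)\<^sup>2 * \<epsilon>s * \<epsilon>t / G s"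

end

context minimal_rotational_surface
begin

text \<open>The speed ratio \<open>R\<close> has logarithmic derivative \<open>m\<close>, which
  cancels the first-order terms of the Laplacian; \<open>R2\<close> puts the s- and t-derivatives
  over the same denominator G; and the constancy of x^2 - z^2 makes the coefficients of J and of the
  rotating term share one eigenvalue.\<close>

lemma has_laplacian_gpart:
  assumes p: "p \<in> M1_domain I" and \<sigma>: "\<sigma> = 1 \<or> \<sigma> = - 1"
  shows "has_laplacian (gpart \<sigma>) p (\<kappa> \<sigma> (p$1) *\<^sub>R gpart \<sigma> p)"
proof -
  define s where "s = p$1"
  have s: "s \<in> I" using p by (simp add: M1_domain_def s_def)
  define \<beta> where "\<beta> = \<sigma> * b"
  have \<beta>: "\<beta>\<^sup>2 = b\<^sup>2" using \<sigma> by (auto simp: \<beta>_def)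
  define k where "k = (\<beta> - 1) * \<epsilon>t"
  define R where "R s = len_s s / len_t s" for s
  define m where "m = deriv E s / (2 * E s) - deriv G s / (2 * G s)"
  have nz: "len_s s \<noteq> 0" "len_t s \<noteq> 0" "E s \<noteq> 0" "G s \<noteq> 0"
    using len_pos[OF s] E_nz[OF s] G_nz[OF s] by auto
  have dR: "(R has_real_derivative R s * m) (at s)"
  proof -
    have 1: "\<epsilon>s * deriv E s / (2 * len_s s) = len_s s * (deriv E s / (2 * E s))"
      "\<epsilon>t * deriv G s / (2 * len_t s) = len_t s * (deriv G s / (2 * G s))"
      using nz len_sq[OF s] by (auto simp: field_simps power2_eq_square)
    have "(R has_real_derivative (len_s s * (deriv E s / (2 * E s)) * len_t s
        - len_s s * (len_t s * (deriv G s / (2 * G s)))) / (len_t s * len_t s)) (at s)"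
      using DERIV_divide[OF DERIV_len[OF s] nz(2)] unfolding R_def[abs_def] 1 .
    then show ?thesis
      by (rule DERIV_cong) (use nz in \<open>simp add: R_def m_def divide_simps\<close>, simp add: algebra_simps)
  qed
  have R2: "(R s)\<^sup>2 / E s = \<epsilon>s * \<epsilon>t / G s"
    using nz len_sq[OF s] \<epsilon>_sq
    by (simp add: R_def power_divide field_simps del: \<epsilon>_sq)
  define X Z where "X = xc \<beta> s" and "Z = zc \<beta> s"
  define c where "c = 1 - \<beta>"
  define x' z' where "x' s = k * R s * (zc \<beta> s)\<^sup>2" and "z' s = k * R s * (xc \<beta> s * zc \<beta> s)" for s
  have dx: "(xc \<beta> has_real_derivative x' s) (at s)"
    and dz: "(zc \<beta> has_real_derivative z' s) (at s)" if "s \<in> I" for s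
    using DERIV_xc_zc[OF that \<beta>] by (simp_all add: k_def R_def x'_def z'_def)
  have dx': "(x' has_real_derivative x' s * m + 2 * k\<^sup>2 * (R s)\<^sup>2 * Z\<^sup>2 * X) (at s)"
    unfolding x'_def[abs_def]
    by (auto intro!: derivative_eq_intros dR dz s simp: z'_def X_def Z_def algebra_simps power2_eq_square)
  have dz': "(z' has_real_derivative z' s * m + k\<^sup>2 * (R s)\<^sup>2 * Z * (X\<^sup>2 + Z\<^sup>2)) (at s)"
    unfolding z'_def[abs_def]
    by (auto intro!: derivative_eq_intros dR dx dz s simp: x'_def z'_def X_def Z_def algebra_simps power2_eq_square)
  define K where "K = - 2 * c\<^sup>2 * Z\<^sup>2 * \<epsilon>s * \<epsilon>t / G s"
  have K: "\<kappa> \<sigma> (p$1) = K"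
    by (simp add: \<kappa>_def K_def Z_def c_def \<beta>_def s_def)
  have k2: "k\<^sup>2 = c\<^sup>2"
    unfolding k_def c_def power_mult_distrib using \<epsilon>_sq(2) by (simp add: power2_eq_square algebra_simps)
  have Jc: "- ((x' s * m + 2 * k\<^sup>2 * (R s)\<^sup>2 * Z\<^sup>2 * X) - deriv E s / (2 * E s) * x' s + deriv G s / (2 * G s) * x' s) / E s
      = K * X"
  proof -
    have "- ((x' s * m + 2 * k\<^sup>2 * (R s)\<^sup>2 * Z\<^sup>2 * X) - deriv E s / (2 * E s) * x' s + deriv G s / (2 * G s) * x' s) / E s
      = - 2 * k\<^sup>2 * Z\<^sup>2 * X * ((R s)\<^sup>2 / E s)"
      by (simp add: m_def algebra_simps)
    also have "\<dots> = K * X"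
      unfolding R2 K_def k2 by simp
    finally show ?thesis .
  qed
  then have Jc': "(x' s * m + 2 * k\<^sup>2 * (R s)\<^sup>2 * Z\<^sup>2 * X - deriv E s / (2 * E s) * x' s + deriv G s / (2 * G s) * x' s) / E s
      = - (K * X)"
    by (simp only: minus_divide_left[symmetric] minus_equation_iff[of _ "K * X"])
  have Zc: "- (((z' s * m + k\<^sup>2 * (R s)\<^sup>2 * Z * (X\<^sup>2 + Z\<^sup>2)) - deriv E s / (2 * E s) * z' s + deriv G s / (2 * G s) * z' s) * h / E s
      + Z * (c\<^sup>2 * h) / G s) = K * (Z * h)" for h
  proof -
    have "- (((z' s * m + k\<^sup>2 * (R s)\<^sup>2 * Z * (X\<^sup>2 + Z\<^sup>2)) - deriv E s / (2 * E s) * z' s + deriv G s / (2 * G s) * z' s) * h / E s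
      + Z * (c\<^sup>2 * h) / G s) = - (k\<^sup>2 * Z * (X\<^sup>2 + Z\<^sup>2) * h * ((R s)\<^sup>2 / E s) + Z * (c\<^sup>2 * h) / G s)"
      by (simp add: m_def algebra_simps add_divide_distrib)
    also have "\<dots> = - c\<^sup>2 * Z * h * ((X\<^sup>2 + Z\<^sup>2) * (\<epsilon>s * \<epsilon>t) + 1) / G s"
      unfolding R2 k2 using nz(4) by (simp add: divide_simps) (simp add: algebra_simps)
    \<comment> \<open>The summand 1 comes from the second t-derivative; X^2 - Z^2 = -\<epsilon>s
      \<epsilon>t turns the bracket into a multiple of Z^2, as in the J coefficient.\<close>
    also have "(X\<^sup>2 + Z\<^sup>2) * (\<epsilon>s * \<epsilon>t) + 1 = 2 * Z\<^sup>2 * (\<epsilon>s * \<epsilon>t)"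
    proof -
      have "X\<^sup>2 = Z\<^sup>2 - \<epsilon>s * \<epsilon>t" using xc_zc_sq[OF s \<beta>] by (simp add: X_def Z_def)
      then show ?thesis using \<epsilon>_sq(1,2) by algebra
    qed
    finally show ?thesis by (simp add: K_def mult.assoc mult.left_commute)
  qed
  \<comment> \<open>The factor cosh (0 t) = 1 brings the J term into the form required by
    \<open>has_laplacian_cosh_sinh\<close>.\<close>
  have "has_laplacian (\<lambda>q. (xc \<beta> (q$1) * cosh (0 * q$2)) *\<^sub>R gJ \<sigma>
      + (zc \<beta> (q$1) * cosh (c * q$2)) *\<^sub>R gC \<sigma> + (zc \<beta> (q$1) * sinh (c * q$2)) *\<^sub>R gS \<sigma>) p
    ((K * X) *\<^sub>R gJ \<sigma> + (K * (Z * cosh (c * p$2))) *\<^sub>R gC \<sigma> + (K * (Z * sinh (c * p$2))) *\<^sub>R gS \<sigma>)"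
    using has_laplacian_cosh_sinh(1)[OF p dx dx'[unfolded s_def], of 0 "gJ \<sigma>"]
      has_laplacian_cosh_sinh(1)[OF p dz dz'[unfolded s_def], of c "gC \<sigma>"]
      has_laplacian_cosh_sinh(2)[OF p dz dz'[unfolded s_def], of c "gS \<sigma>"]
      Jc' Zc
    by (intro has_laplacian_add) (simp_all add: s_def[symmetric] Z_def[symmetric])
  moreover have "(\<lambda>q. (xc \<beta> (q$1) * cosh (0 * q$2)) *\<^sub>R gJ \<sigma>
      + (zc \<beta> (q$1) * cosh (c * q$2)) *\<^sub>R gC \<sigma> + (zc \<beta> (q$1) * sinh (c * q$2)) *\<^sub>R gS \<sigma>) = gpart \<sigma>"
    by (simp add: gpart_def fun_eq_iff \<beta>_def c_def)
  moreover have "(K * X) *\<^sub>R gJ \<sigma> + (K * (Z * cosh (c * p$2))) *\<^sub>R gC \<sigma> + (K * (Z * sinh (c * p$2))) *\<^sub>R gS \<sigma>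
      = \<kappa> \<sigma> (p$1) *\<^sub>R gpart \<sigma> p"
    by (simp add: gpart_def \<beta>_def c_def K X_def Z_def s_def algebra_simps)
  ultimately show ?thesis by simp
qed

end

section \<open>Gauss maps\<close>

lemma constant_on_interval:
  fixes f :: "real \<Rightarrow> real"
  assumes "is_interval I" "\<And>s. s \<in> I \<Longrightarrow> (f has_real_derivative 0) (at s)"
  shows "\<exists>c. \<forall>s\<in>I. f s = c"
  by (rule has_field_derivative_zero_constant)
    (use assms in \<open>auto simp: is_interval_convex intro: has_field_derivative_at_within\<close>)

lemma wedge_scaleR: "wedge (a *\<^sub>R u) (c *\<^sub>R v) = (a * c) *\<^sub>R wedge u v"
  by (simp add: wedge_def vec_eq_iff algebra_simps)

lemma wedge_combination:
  "wedge (a *\<^sub>R u + c *\<^sub>R v) (a' *\<^sub>R u + c' *\<^sub>R v) = (a * c' - c * a') *\<^sub>R wedge u v"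
  by (simp add: wedge_def vec_eq_iff algebra_simps)

lemma wedge_in_bivectors: "wedge u v \<in> bivectors"
  by (simp add: wedge_def bivectors_def transpose_def vec_eq_iff)

lemma bivectors_add: "A \<in> bivectors \<Longrightarrow> B \<in> bivectors \<Longrightarrow> A + B \<in> bivectors"
  and bivectors_scaleR: "A \<in> bivectors \<Longrightarrow> c *\<^sub>R A \<in> bivectors"
proof -
  have "transpose (A + B) = transpose A + transpose B" "transpose (c *\<^sub>R A) = c *\<^sub>R transpose A"
    by (simp_all add: transpose_def vec_eq_iff)
  then show "A \<in> bivectors \<Longrightarrow> B \<in> bivectors \<Longrightarrow> A + B \<in> bivectors"
    "A \<in> bivectors \<Longrightarrow> c *\<^sub>R A \<in> bivectors"
    by (simp_all add: bivectors_def)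
qed

lemma gJ_gC_in_bivectors: "gJ \<sigma> \<in> bivectors" "gC \<sigma> \<in> bivectors"
proof -
  have "gJ \<sigma> = 1 *\<^sub>R e2 2 3 + (- \<sigma>) *\<^sub>R e2 1 4" "gC \<sigma> = (- \<sigma>) *\<^sub>R e2 1 2 + (- 1) *\<^sub>R e2 3 4"
    by (simp_all add: gJ_def gC_def)
  then show "gJ \<sigma> \<in> bivectors" "gC \<sigma> \<in> bivectors"
    by (simp_all only: e2_def bivectors_add bivectors_scaleR wedge_in_bivectors)
qed

text \<open>On bivectors, twice the coordinates with respect to \<open>gJ \<sigma>\<close>,
  \<open>gC \<sigma>\<close>, \<open>gS \<sigma>\<close> when \<sigma> is 1 or -1; they annihilate
  the opposite eigenspace, as 1 + \<sigma> \<tau> = 0 for opposite signs.\<close>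

definition cJ :: "real \<Rightarrow> real^4^4 \<Rightarrow> real" where "cJ \<sigma> A = A$2$3 - \<sigma> * A$1$4"
definition cC :: "real \<Rightarrow> real^4^4 \<Rightarrow> real" where "cC \<sigma> A = - \<sigma> * A$1$2 - A$3$4"
definition cS :: "real \<Rightarrow> real^4^4 \<Rightarrow> real" where "cS \<sigma> A = A$1$3 + \<sigma> * A$2$4"

lemma coefficients_add:
  "cJ \<sigma> (A + B) = cJ \<sigma> A + cJ \<sigma> B" "cC \<sigma> (A + B) = cC \<sigma> A + cC \<sigma> B"
  "cS \<sigma> (A + B) = cS \<sigma> A + cS \<sigma> B"
  and coefficients_scaleR:
  "cJ \<sigma> (k *\<^sub>R A) = k * cJ \<sigma> A" "cC \<sigma> (k *\<^sub>R A) = k * cC \<sigma> A" "cS \<sigma> (k *\<^sub>R A) = k * cS \<sigma> A"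
  by (simp_all add: cJ_def cC_def cS_def algebra_simps)

lemma coefficients_basis:
  "cJ \<sigma> (gJ \<tau>) = 1 + \<sigma> * \<tau>" "cC \<sigma> (gJ \<tau>) = 0" "cS \<sigma> (gJ \<tau>) = 0"
  "cJ \<sigma> (gC \<tau>) = 0" "cC \<sigma> (gC \<tau>) = 1 + \<sigma> * \<tau>" "cS \<sigma> (gC \<tau>) = 0"
  "cJ \<sigma> (gS \<tau>) = 0" "cC \<sigma> (gS \<tau>) = 0" "cS \<sigma> (gS \<tau>) = 1 + \<sigma> * \<tau>"
  by (simp_all add: cJ_def cC_def cS_def gJ_def gC_def gS_def e2_def wedge_def axis_def)

text \<open>Sums and differences over the two signs recover the six entries above the diagonal;
  antisymmetry gives the others.\<close>

lemma bivector_coefficients_nonzero: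
  assumes "C \<in> bivectors" "C \<noteq> 0"
  shows "\<exists>\<sigma>. (\<sigma> = 1 \<or> \<sigma> = - 1) \<and> (cJ \<sigma> C \<noteq> 0 \<or> cC \<sigma> C \<noteq> 0 \<or> cS \<sigma> C \<noteq> 0)"
proof (rule ccontr)
  assume "\<not> ?thesis"
  then have "cJ 1 C = 0" "cC 1 C = 0" "cS 1 C = 0" "cJ (-1) C = 0" "cC (-1) C = 0" "cS (-1) C = 0"
    by auto
  then have zero: "C$2$3 = 0" "C$1$4 = 0" "C$1$2 = 0" "C$3$4 = 0" "C$1$3 = 0" "C$2$4 = 0"
    unfolding cJ_def cC_def cS_def by linarith+
  have anti: "C$i$j = - C$j$i" for i j
  proof -
    have "transpose C $ j $ i = (- C) $ j $ i"
      using assms(1) by (simp add: bivectors_def)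
    then show ?thesis by (simp add: transpose_def)
  qed
  have "C$i$i = 0" for i
    using anti[of i i] by simp
  then have "C = 0"
    using zero anti[of 2 1] anti[of 3 1] anti[of 4 1] anti[of 3 2] anti[of 4 2] anti[of 4 3]
    by (simp add: vec_eq_iff forall_4)
  then show False using assms(2) by simp
qed

lemma det_scale_rows_4:
  fixes u v n m :: "real^4"
  shows "det (vector [c1 *\<^sub>R u, c2 *\<^sub>R v, c3 *\<^sub>R n, c4 *\<^sub>R m] :: real^4^4) =
    c1 * c2 * c3 * c4 * det (vector [u, v, n, m] :: real^4^4)"
  by (simp add: det_4 algebra_simps)

lemma continuous_on_wedge:
  "continuous_on S f \<Longrightarrow> continuous_on S g \<Longrightarrow> continuous_on S (\<lambda>x. wedge (f x) (g x))"
  unfolding wedge_def by (intro continuous_intros)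

section \<open>An explicit normal frame, and the sign ambiguity of the Gauss map\<close>

context rotational_surface
begin

lemma \<epsilon>_nz [simp]: "\<epsilon>s \<noteq> 0" "\<epsilon>t \<noteq> 0"
  using \<epsilon>_sq(3,4) abs_zero zero_neq_one by metis+

text \<open>This is \<open>rs\<close> with y' and w' exchanged; \<open>n2\<close> is
  \<open>rt\<close> with w and b y exchanged. The exchange reverses the squared lengths, as the
  neutral signature requires.\<close>

definition n1 :: "real^2 \<Rightarrow> real^4" where
  "n1 q = vector [deriv y (q$1) * sinh (q$2), deriv w (q$1) * cosh (b * q$2),
    deriv w (q$1) * sinh (b * q$2), deriv y (q$1) * cosh (q$2)]"

definition n2 :: "real^2 \<Rightarrow> real^4" where
  "n2 q = vector [b * y (q$1) * cosh (q$2), w (q$1) * sinh (b * q$2),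
    w (q$1) * cosh (b * q$2), b * y (q$1) * sinh (q$2)]"

lemma cosh_sq: "(cosh x)\<^sup>2 - (sinh x)\<^sup>2 = 1" for x :: real
  by (simp add: cosh_square_eq)

lemma inner_normals:
  "E42_inner (n1 q) (n1 q) = - E (q$1)" "E42_inner (n2 q) (n2 q) = - G (q$1)"
  "E42_inner (n1 q) (n2 q) = 0" "E42_inner (rs q) (n1 q) = 0" "E42_inner (rs q) (n2 q) = 0"
  "E42_inner (rt q) (n1 q) = 0" "E42_inner (rt q) (n2 q) = 0"
proof -
  note h = cosh_sq[of "q$2"] cosh_sq[of "b * q$2"]
  show "E42_inner (n1 q) (n1 q) = - E (q$1)"
    using h unfolding E42_inner_def n1_def vector_4 E_def by algebra
  show "E42_inner (n2 q) (n2 q) = - G (q$1)"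
    using h unfolding E42_inner_def n2_def vector_4 G_def by algebra
  show "E42_inner (n1 q) (n2 q) = 0"
    unfolding E42_inner_def n1_def n2_def vector_4 by algebra
  show "E42_inner (rs q) (n1 q) = 0"
    using h unfolding E42_inner_def n1_def rs_def vector_4 by algebra
  show "E42_inner (rs q) (n2 q) = 0"
    unfolding E42_inner_def n2_def rs_def vector_4 by algebra
  show "E42_inner (rt q) (n1 q) = 0"
    unfolding E42_inner_def n1_def rt_def vector_4 by algebra
  show "E42_inner (rt q) (n2 q) = 0"
    using h unfolding E42_inner_def n2_def rt_def vector_4 by algebra
qed

lemma E42_inner_normal:
  "E42_inner (a *\<^sub>R n1 q + c *\<^sub>R n2 q) (a' *\<^sub>R n1 q + c' *\<^sub>R n2 q) =
    - (E (q$1) * a * a' + G (q$1) * c * c')"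
proof -
  have "E42_inner (a *\<^sub>R n1 q + c *\<^sub>R n2 q) (a' *\<^sub>R n1 q + c' *\<^sub>R n2 q) =
      a * a' * E42_inner (n1 q) (n1 q) + c * c' * E42_inner (n2 q) (n2 q)
      + (a * c' + c * a') * E42_inner (n1 q) (n2 q)"
    unfolding E42_inner_def by (simp add: algebra_simps)
  then show ?thesis by (simp add: inner_normals)
qed

lemma det_adapted: "det (vector [rs q, rt q, n1 q, n2 q] :: real^4^4) = E (q$1) * G (q$1)"
proof -
  have "det (vector [rs q, rt q, n1 q, n2 q] :: real^4^4) =
    E (q$1) * G (q$1) * ((cosh (q$2))\<^sup>2 - (sinh (q$2))\<^sup>2) * ((cosh (b * q$2))\<^sup>2 - (sinh (b * q$2))\<^sup>2)"
    unfolding det_4 vector_4 rs_def rt_def n1_def n2_def E_def G_def by algebra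
  then show ?thesis unfolding cosh_sq by simp
qed

text \<open>\<open>rs\<close>, \<open>rt\<close>, \<open>n1\<close>, \<open>n2\<close> are mutually
  orthogonal with nonzero squared lengths E, G, -E, -G, so a vector is the sum of its projections
  onto them.\<close>

lemma normal_expansion:
  assumes q: "q \<in> M1_domain I" and v: "E42_inner (rs q) v = 0" "E42_inner (rt q) v = 0"
  shows "v = (- E42_inner v (n1 q) / E (q$1)) *\<^sub>R n1 q + (- E42_inner v (n2 q) / G (q$1)) *\<^sub>R n2 q"
proof -
  have s: "q$1 \<in> I" using q by (simp add: M1_domain_def)
  \<comment> \<open>Before cosh^2 - sinh^2 = 1 is applied, the expansion times E G is a polynomial
    identity carrying one such factor: argument t for indices 1 and 4, argument b t for 2 and
    3.\<close>
  define c where "c (i::4) = (if i = 1 \<or> i = 4 then (cosh (q$2))\<^sup>2 - (sinh (q$2))\<^sup>2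
    else (cosh (b * q$2))\<^sup>2 - (sinh (b * q$2))\<^sup>2)" for i
  have key: "E (q$1) * G (q$1) * v $ i = - (G (q$1) * E42_inner v (n1 q) * n1 q $ i + E (q$1) * E42_inner v (n2 q) * n2 q $ i)" for i
  proof -
    have "G (q$1) * (E42_inner (rs q) v * rs q $ i - E42_inner v (n1 q) * n1 q $ i)
        + E (q$1) * (E42_inner (rt q) v * rt q $ i - E42_inner v (n2 q) * n2 q $ i) = E (q$1) * G (q$1) * v $ i * c i"
      using exhaust_4[of i]
      by (elim disjE) (simp_all add: c_def E42_inner_def rs_def rt_def n1_def n2_def E_def G_def
          algebra_simps power2_eq_square)
    then show ?thesis unfolding v c_def cosh_sq by simp
  qed
  have "v $ i = (- E42_inner v (n1 q) / E (q$1)) * n1 q $ i + (- E42_inner v (n2 q) / G (q$1)) * n2 q $ i" for i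
  proof -
    have "v $ i = (E (q$1) * G (q$1) * v $ i) / (E (q$1) * G (q$1))"
      using E_nz[OF s] G_nz[OF s] by simp
    then show ?thesis
      unfolding key using E_nz[OF s] G_nz[OF s] by (simp add: diff_divide_distrib)
  qed
  then show ?thesis by (simp add: vec_eq_iff)
qed

text \<open>Entries (1,4) and (2,3) of the wedge are free of t; the others combine products of a
  hyperbolic function of t and one of b t. The addition theorems sort these by (1 - b) t and (1 + b)
  t, which is exactly the splitting by duality.\<close>

lemma wedge_normals:
  assumes q: "q \<in> M1_domain I"
  shows "wedge (n1 q) (n2 q) = (len_s (q$1) * len_t (q$1)) *\<^sub>R ((1/2) *\<^sub>R (gpart 1 q + gpart (-1) q))"
proof -
  define s where "s = q$1"
  define t where "t = q$2"
  have "s \<in> I" using q by (simp add: M1_domain_def s_def)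
  from len_pos[OF this] have x: "len_s s * len_t s * xc \<beta> s = \<beta> * y s * deriv y s + w s * deriv w s"
    and z: "len_s s * len_t s * zc \<beta> s = w s * deriv y s + \<beta> * y s * deriv w s" for \<beta>
    by (simp_all add: xc_def zc_def y1_def w1_def field_simps)
  have scaled: "(len_s s * len_t s) *\<^sub>R ((1/2) *\<^sub>R (gpart 1 q + gpart (-1) q)) = (1/2) *\<^sub>R (
      (len_s s * len_t s * xc b s) *\<^sub>R gJ 1
      + (len_s s * len_t s * zc b s * cosh (t - b * t)) *\<^sub>R gC 1
      + (len_s s * len_t s * zc b s * sinh (t - b * t)) *\<^sub>R gS 1
      + (len_s s * len_t s * xc (- b) s) *\<^sub>R gJ (-1)
      + (len_s s * len_t s * zc (- b) s * cosh (t + b * t)) *\<^sub>R gC (-1)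
      + (len_s s * len_t s * zc (- b) s * sinh (t + b * t)) *\<^sub>R gS (-1))"
    unfolding gpart_def s_def[symmetric] t_def[symmetric]
    by (simp add: algebra_simps)
  \<comment> \<open>\<open>sq\<close> and its variant \<open>sq'\<close> with a trailing factor
    eliminate cosh^2 wherever it stands in a product.\<close>
  have sq: "cosh x * cosh x = 1 + sinh x * sinh x" for x :: real
    using cosh_sq[of x] by (simp add: power2_eq_square algebra_simps)
  have sq': "cosh x * (cosh x * k) = k + sinh x * (sinh x * k)" for x k :: real
    using arg_cong[OF sq[of x], of "\<lambda>u. u * k"] by (simp add: algebra_simps)
  show ?thesis
    unfolding s_def[symmetric] scaled x z
    by (simp add: vec_eq_iff forall_4 wedge_def n1_def n2_def gJ_def gC_def gS_def e2_def axis_def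
        s_def[symmetric] t_def[symmetric] cosh_add cosh_diff sinh_add sinh_diff field_simps sq sq')
qed

text \<open>The sign \<open>\<epsilon>s * \<epsilon>t\<close> makes the frame positively oriented,
  since the determinant before normalisation is E G (\<open>det_adapted\<close>).\<close>

definition unit_normal :: "2 \<Rightarrow> real^2 \<Rightarrow> real^4" where
  "unit_normal i q = (if i = 1 then (1 / len_s (q$1)) *\<^sub>R n1 q else (\<epsilon>s * \<epsilon>t / len_t (q$1)) *\<^sub>R n2 q)"

lemma unit_normal_12:
  "unit_normal 1 = (\<lambda>q. (1 / len_s (q$1)) *\<^sub>R n1 q)"
  "unit_normal 2 = (\<lambda>q. (\<epsilon>s * \<epsilon>t / len_t (q$1)) *\<^sub>R n2 q)"
  by (simp_all add: unit_normal_def fun_eq_iff)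

lemma smooth_unit_normal: "smooth_on (M1_domain I) (unit_normal i)"
proof -
  note o = open_M1_domain[OF open_I]
  have n: "n1 = (\<lambda>q. (deriv y (q$1) * sinh (1 * q$2)) *\<^sub>R axis 1 1 + (deriv w (q$1) * cosh (b * q$2)) *\<^sub>R axis 2 1
      + (deriv w (q$1) * sinh (b * q$2)) *\<^sub>R axis 3 1 + (deriv y (q$1) * cosh (1 * q$2)) *\<^sub>R axis 4 1)"
    "n2 = (\<lambda>q. (b * (y (q$1) * cosh (1 * q$2))) *\<^sub>R axis 1 1 + (w (q$1) * sinh (b * q$2)) *\<^sub>R axis 2 1
      + (w (q$1) * cosh (b * q$2)) *\<^sub>R axis 3 1 + (b * (y (q$1) * sinh (1 * q$2))) *\<^sub>R axis 4 1)"
    by (simp_all add: n1_def n2_def fun_eq_iff vec_eq_iff forall_4 axis_def)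
  note fc = smooth_profile[THEN smooth_on_fst_component[OF open_I]]
    smooth_len[THEN smooth_on_fst_component[OF open_I]]
  have ns: "smooth_on (M1_domain I) n1" "smooth_on (M1_domain I) n2"
    unfolding n
    by (intro smooth_on_add smooth_on_scaleR smooth_on_mult smooth_on_const smooth_on_cosh
        smooth_on_sinh fc o)+
  have nz: "len_s (q$1) \<noteq> 0" "len_t (q$1) \<noteq> 0" if "q \<in> M1_domain I" for q
    using len_pos[of "q$1"] that by (auto simp: M1_domain_def)
  have "smooth_on (M1_domain I) (unit_normal 1)" "smooth_on (M1_domain I) (unit_normal 2)"
    unfolding unit_normal_12 by (intro smooth_on_scaleR smooth_on_divide smooth_on_const fc o ns nz; assumption)+
  then show ?thesis using exhaust_2[of i] by auto
qed

lemma adapted_unit_frame: "adapted_frame r (M1_domain I) unit_frame unit_normal"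
proof -
  have "(\<forall>i. \<bar>E42_inner (unit_normal i q) (unit_normal i q)\<bar> = 1) \<and>
      E42_inner (unit_normal 1 q) (unit_normal 2 q) = 0 \<and>
      (\<forall>i j. E42_inner (push r (unit_frame i) q) (unit_normal j q) = 0) \<and>
      det (vector [push r (unit_frame 1) q, push r (unit_frame 2) q, unit_normal 1 q, unit_normal 2 q] :: real^4^4) > 0"
    if q: "q \<in> M1_domain I" for q
  proof (intro conjI)
    have s: "q$1 \<in> I" using q by (simp add: M1_domain_def)
    note nz = E_nz[OF s] G_nz[OF s]
    have "E (q$1) / (len_s (q$1))\<^sup>2 = \<epsilon>s" "G (q$1) / (len_t (q$1))\<^sup>2 = \<epsilon>t"
      using nz divide_\<epsilon>(1)[of 1] divide_\<epsilon>(2)[of 1] by (simp_all add: len_sq[OF s])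
    moreover have "E42_inner (unit_normal 1 q) (unit_normal 1 q) = - (E (q$1) / (len_s (q$1))\<^sup>2)"
      unfolding unit_normal_12
      using E42_inner_normal[of "1 / len_s (q$1)" q 0 "1 / len_s (q$1)" 0]
      by (simp add: power2_eq_square)
    moreover have "E42_inner (unit_normal 2 q) (unit_normal 2 q) =
        - (G (q$1) / (len_t (q$1))\<^sup>2 * ((\<epsilon>s * \<epsilon>s) * (\<epsilon>t * \<epsilon>t)))"
      unfolding unit_normal_12
      using E42_inner_normal[of 0 q "\<epsilon>s * \<epsilon>t / len_t (q$1)" 0 "\<epsilon>s * \<epsilon>t / len_t (q$1)"]
      by (simp add: power2_eq_square ac_simps del: \<epsilon>_sq)
    ultimately have "E42_inner (unit_normal 1 q) (unit_normal 1 q) = - \<epsilon>s"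
      "E42_inner (unit_normal 2 q) (unit_normal 2 q) = - \<epsilon>t"
      by simp_all
    then show "\<forall>i. \<bar>E42_inner (unit_normal i q) (unit_normal i q)\<bar> = 1"
      by (simp add: forall_2)
    show "E42_inner (unit_normal 1 q) (unit_normal 2 q) = 0"
      unfolding unit_normal_12
      using E42_inner_normal[of "1 / len_s (q$1)" q 0 0 "\<epsilon>s * \<epsilon>t / len_t (q$1)"] by simp
    have scale: "E42_inner (a *\<^sub>R u) (c *\<^sub>R v) = a * c * E42_inner u v" for a c u v
      by (simp add: E42_inner_def algebra_simps)
    show "\<forall>i j. E42_inner (push r (unit_frame i) q) (unit_normal j q) = 0"
      by (simp add: forall_2 push_unit_frame[OF q] unit_normal_12 scale inner_normals)
    show "det (vector [push r (unit_frame 1) q, push r (unit_frame 2) q, unit_normal 1 q, unit_normal 2 q] :: real^4^4) > 0"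
    proof -
      have "det (vector [push r (unit_frame 1) q, push r (unit_frame 2) q, unit_normal 1 q, unit_normal 2 q] :: real^4^4)
        = (\<epsilon>s * E (q$1)) * (\<epsilon>t * G (q$1)) / ((len_s (q$1))\<^sup>2 * (len_t (q$1))\<^sup>2)"
        unfolding push_unit_frame[OF q] unit_normal_12 det_scale_rows_4 det_adapted
        by (simp add: power2_eq_square ac_simps)
      also have "\<dots> > 0"
        using \<epsilon>E_pos[OF s] \<epsilon>G_pos[OF s] len_pos[OF s]
        by (simp only: mult_pos_pos divide_pos_pos zero_less_power)
      finally show ?thesis .
    qed
  qed
  then show ?thesis
    unfolding adapted_frame_def using tangent_unit_frame smooth_unit_normal by blast
qed

definition \<nu>\<^sub>0 :: "real^2 \<Rightarrow> real^4^4" where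
  "\<nu>\<^sub>0 q = (\<epsilon>s * \<epsilon>t / 2) *\<^sub>R (gpart 1 q + gpart (-1) q)"

lemma wedge_unit_normal:
  assumes q: "q \<in> M1_domain I"
  shows "wedge (unit_normal 1 q) (unit_normal 2 q) = \<nu>\<^sub>0 q"
  using len_pos[of "q$1"] q
  by (simp add: unit_normal_12 wedge_scaleR wedge_normals[OF q] \<nu>\<^sub>0_def M1_domain_def)

lemma is_gauss_map_\<nu>\<^sub>0: "is_gauss_map r (M1_domain I) \<nu>\<^sub>0"
  unfolding is_gauss_map_def using adapted_unit_frame wedge_unit_normal by (metis order_refl)

lemma continuous_\<nu>\<^sub>0: "continuous_on (M1_domain I) \<nu>\<^sub>0"
proof -
  have "continuous_on (M1_domain I) (\<lambda>q. wedge (unit_normal 1 q) (unit_normal 2 q))"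
    by (intro continuous_on_wedge smooth_on_imp_continuous_on smooth_unit_normal)
  then show ?thesis
    using wedge_unit_normal by (metis (no_types, lifting) continuous_on_cong)
qed

lemma \<nu>\<^sub>0_coefficients:
  assumes "\<sigma> = 1 \<or> \<sigma> = - 1"
  shows "cJ \<sigma> (a *\<^sub>R gpart 1 p + c *\<^sub>R gpart (-1) p) = 2 * (if \<sigma> = 1 then a else c) * xc (\<sigma> * b) (p$1)"
    "cC \<sigma> (a *\<^sub>R gpart 1 p + c *\<^sub>R gpart (-1) p)
      = 2 * (if \<sigma> = 1 then a else c) * (zc (\<sigma> * b) (p$1) * cosh ((1 - \<sigma> * b) * p$2))"
    "cS \<sigma> (a *\<^sub>R gpart 1 p + c *\<^sub>R gpart (-1) p)
      = 2 * (if \<sigma> = 1 then a else c) * (zc (\<sigma> * b) (p$1) * sinh ((1 - \<sigma> * b) * p$2))"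
  using assms unfolding gpart_def
  by (auto simp: coefficients_add coefficients_scaleR coefficients_basis)

lemma gpart_nonzero:
  assumes p: "p \<in> M1_domain I" and \<sigma>: "\<sigma> = 1 \<or> \<sigma> = - 1"
  shows "xc (\<sigma> * b) (p$1) \<noteq> 0 \<or> zc (\<sigma> * b) (p$1) \<noteq> 0"
proof -
  have "(xc (\<sigma> * b) (p$1))\<^sup>2 - (zc (\<sigma> * b) (p$1))\<^sup>2 = - (\<epsilon>s * \<epsilon>t)"
    by (rule xc_zc_sq) (use p \<sigma> in \<open>auto simp: M1_domain_def\<close>)
  moreover have "\<epsilon>s * \<epsilon>t \<noteq> 0" using \<epsilon>_sq(3,4) by (metis abs_zero mult_eq_0_iff zero_neq_one)
  ultimately show ?thesis by auto
qed

text \<open>Reversing one tangent and one normal vector keeps a frame adapted but reverses the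
  wedge, so the sign is free. Continuity makes it locally constant, which suffices because the
  Laplacian is local.\<close>

lemma gauss_map_pm:
  assumes \<nu>: "is_gauss_map r (M1_domain I) \<nu>" and p: "p \<in> M1_domain I"
  obtains k V where "k = 1 \<or> k = - 1" "open V" "p \<in> V" "\<And>q. q \<in> V \<Longrightarrow> \<nu> q = k *\<^sub>R \<nu>\<^sub>0 q"
proof -
  obtain U X N where U: "p \<in> U" "U \<subseteq> M1_domain I" and fr: "adapted_frame r U X N"
    and \<nu>N: "\<And>q. q \<in> U \<Longrightarrow> \<nu> q = wedge (N 1 q) (N 2 q)"
    using \<nu> p unfolding is_gauss_map_def by metis
  have "open U" using fr by (simp add: adapted_frame_def tangent_frame_def)
  have pm: "\<exists>k. (k = 1 \<or> k = - 1) \<and> \<nu> q = k *\<^sub>R \<nu>\<^sub>0 q" if qU: "q \<in> U" for q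
  proof -
    have q: "q \<in> M1_domain I" using qU U by blast
    then have s: "q$1 \<in> I" by (simp add: M1_domain_def)
    have Nn: "\<bar>E42_inner (N i q) (N i q)\<bar> = 1" "E42_inner (N 1 q) (N 2 q) = 0"
      "E42_inner (push r (X i) q) (N j q) = 0" for i j
      using fr qU unfolding adapted_frame_def by blast+
    have Xn: "\<bar>E42_inner (push r (X i) q) (push r (X i) q)\<bar> = 1"
      "E42_inner (push r (X 1) q) (push r (X 2) q) = 0" for i
      using fr qU unfolding adapted_frame_def tangent_frame_def by blast+
    \<comment> \<open>By the Gram determinant the coefficient matrix of \<open>X 1\<close>,
      \<open>X 2\<close> is invertible, so vectors normal to the frame are normal to
      \<open>rs\<close> and \<open>rt\<close>.\<close>
    have orth: "E42_inner (rs q) (N j q) = 0 \<and> E42_inner (rt q) (N j q) = 0" for j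
    proof -
      define a c where "a i = X i q $ 1" and "c i = X i q $ 2" for i
      have lin: "a i * E42_inner (rs q) (N j q) + c i * E42_inner (rt q) (N j q) = 0" for i
        using Nn(3)[of i j] unfolding push_r[OF q] a_def c_def E42_inner_def
        by (simp add: algebra_simps)
      have *: "\<bar>E (q$1) * a i * a i + G (q$1) * c i * c i\<bar> = 1"
        "E (q$1) * a 1 * a 2 + G (q$1) * c 1 * c 2 = 0" for i
        using Xn unfolding push_r[OF q] E42_inner_tangent a_def c_def by blast+
      have "(E (q$1) * G (q$1)) * (a 1 * c 2 - c 1 * a 2)\<^sup>2
          = (E (q$1) * a 1 * a 1 + G (q$1) * c 1 * c 1) * (E (q$1) * a 2 * a 2 + G (q$1) * c 2 * c 2)
            - (E (q$1) * a 1 * a 2 + G (q$1) * c 1 * c 2)\<^sup>2"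
        by algebra
      moreover have "(E (q$1) * a 1 * a 1 + G (q$1) * c 1 * c 1) * (E (q$1) * a 2 * a 2 + G (q$1) * c 2 * c 2) \<noteq> 0"
        using *(1)[of 1] *(1)[of 2] by auto
      ultimately have det: "a 1 * c 2 - c 1 * a 2 \<noteq> 0"
        using *(2) by auto
      have "(a 1 * c 2 - c 1 * a 2) * E42_inner (rs q) (N j q) = 0"
        "(a 1 * c 2 - c 1 * a 2) * E42_inner (rt q) (N j q) = 0"
        using lin[of 1] lin[of 2] by (algebra, algebra)
      then show ?thesis using det by auto
    qed
    obtain a c a' c' where N1: "N 1 q = a *\<^sub>R n1 q + c *\<^sub>R n2 q" and N2: "N 2 q = a' *\<^sub>R n1 q + c' *\<^sub>R n2 q"
      using normal_expansion[OF q, of "N 1 q"] normal_expansion[OF q, of "N 2 q"] orth by blast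
    \<comment> \<open>Determinant of the change of normal basis. Comparing Gram determinants gives
      |E G d^2| = 1, so after normalisation the wedge changes by a sign only.\<close>
    define d where "d = a * c' - c * a'"
    define A where "A = (E (q$1) * a * a + G (q$1) * c * c) * (E (q$1) * a' * a' + G (q$1) * c' * c')"
    have "\<bar>A\<bar> = 1"
      using Nn(1)[of 1] Nn(1)[of 2] unfolding N1 N2 E42_inner_normal A_def abs_minus_cancel abs_mult
      by simp
    moreover have "A = E (q$1) * G (q$1) * d\<^sup>2"
      using Nn(2) unfolding N1 N2 E42_inner_normal A_def d_def by algebra
    moreover have "(len_s (q$1) * len_t (q$1) * d)\<^sup>2 = \<epsilon>s * \<epsilon>t * (E (q$1) * G (q$1) * d\<^sup>2)"
      by (simp add: power_mult_distrib len_sq[OF s])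
    ultimately have "\<bar>(len_s (q$1) * len_t (q$1) * d)\<^sup>2\<bar> = 1"
      by (simp add: abs_mult)
    then have "len_s (q$1) * len_t (q$1) * d = 1 \<or> len_s (q$1) * len_t (q$1) * d = - 1"
      by (simp add: power2_eq_1_iff)
    moreover have "\<epsilon>s * \<epsilon>t = 1 \<or> \<epsilon>s * \<epsilon>t = - 1"
      using \<epsilon>_sq(3,4) by (auto simp: abs_if split: if_splits)
    moreover have "\<nu> q = (len_s (q$1) * len_t (q$1) * d * (\<epsilon>s * \<epsilon>t)) *\<^sub>R \<nu>\<^sub>0 q"
    proof -
      have "(\<epsilon>s * \<epsilon>t) * (\<epsilon>s * \<epsilon>t) = 1" by (simp add: mult.left_commute mult.assoc)
      then have "(len_s (q$1) * len_t (q$1) * d * (\<epsilon>s * \<epsilon>t)) *\<^sub>R \<nu>\<^sub>0 q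
        = (len_s (q$1) * len_t (q$1) * d) *\<^sub>R ((1/2) *\<^sub>R (gpart 1 q + gpart (-1) q))"
        unfolding \<nu>\<^sub>0_def by (simp add: mult.assoc[symmetric])
      moreover have "\<nu> q = d *\<^sub>R wedge (n1 q) (n2 q)"
        unfolding \<nu>N[OF qU] N1 N2 wedge_combination d_def ..
      ultimately show ?thesis
        by (simp add: wedge_normals[OF q] mult.commute)
    qed
    ultimately show ?thesis by (metis mult_1 mult_minus1 minus_minus)
  qed
  have nz: "\<nu>\<^sub>0 q \<noteq> 0" if "q \<in> U" for q
  proof
    assume "\<nu>\<^sub>0 q = 0"
    then have "1 *\<^sub>R gpart 1 q + 1 *\<^sub>R gpart (-1) q = 0"
      using \<epsilon>_sq(3,4) by (auto simp: \<nu>\<^sub>0_def)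
    then have "cJ 1 (1 *\<^sub>R gpart 1 q + 1 *\<^sub>R gpart (-1) q) = 0" "cC 1 (1 *\<^sub>R gpart 1 q + 1 *\<^sub>R gpart (-1) q) = 0"
      by (simp_all add: cJ_def cC_def)
    then have "xc (1 * b) (q$1) = 0" "zc (1 * b) (q$1) = 0"
      by (simp_all add: \<nu>\<^sub>0_coefficients del: scaleR_one)
    then show False using gpart_nonzero[of q 1] that U by auto
  qed
  \<comment> \<open>The Euclidean inner product serves to detect the sign continuously: f q is the
    sign at q times a positive number.\<close>
  define f where "f q = \<nu> q \<bullet> \<nu>\<^sub>0 q" for q
  have "continuous_on U (\<lambda>q. wedge (N 1 q) (N 2 q))"
    using fr unfolding adapted_frame_def
    by (intro continuous_on_wedge smooth_on_imp_continuous_on) auto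
  then have "continuous_on U \<nu>"
    by (rule continuous_on_eq) (simp add: \<nu>N)
  then have "continuous_on U (\<lambda>q. f q * f p)"
    unfolding f_def using continuous_on_subset[OF continuous_\<nu>\<^sub>0 U(2)] by (intro continuous_intros)
  then have o: "open (U \<inter> (\<lambda>q. f q * f p) -` {0<..})"
    using \<open>open U\<close> by (intro continuous_open_preimage) auto
  obtain k where k: "k = 1 \<or> k = - 1" "\<nu> p = k *\<^sub>R \<nu>\<^sub>0 p" using pm[OF U(1)] by blast
  have fk: "f q = l * (\<nu>\<^sub>0 q \<bullet> \<nu>\<^sub>0 q)" if "\<nu> q = l *\<^sub>R \<nu>\<^sub>0 q" for q l
    using that by (simp add: f_def)
  have pos: "\<nu>\<^sub>0 q \<bullet> \<nu>\<^sub>0 q > 0" if "q \<in> U" for q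
    using nz[OF that] by simp
  show ?thesis
  proof (rule that[OF k(1) o])
    have "f p \<noteq> 0" using k fk[OF k(2)] pos[OF U(1)] by auto
    then show "p \<in> U \<inter> (\<lambda>q. f q * f p) -` {0<..}"
      using U(1) by (auto simp: zero_less_mult_iff linorder_neq_iff)
    show "\<nu> q = k *\<^sub>R \<nu>\<^sub>0 q" if q: "q \<in> U \<inter> (\<lambda>q. f q * f p) -` {0<..}" for q
    proof -
      have qU: "q \<in> U" and fpos: "f q * f p > 0" using q by auto
      obtain l where l: "l = 1 \<or> l = - 1" "\<nu> q = l *\<^sub>R \<nu>\<^sub>0 q" using pm[OF qU] by blast
      have "l * k > 0"
        using fpos pos[OF qU] pos[OF U(1)] unfolding fk[OF l(2)] fk[OF k(2)]
        by (simp add: zero_less_mult_iff mult_less_0_iff)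
      then have "l = k" using l(1) k(1) by auto
      then show ?thesis using l(2) by simp
    qed
  qed
qed

lemma smooth_\<kappa>: "smooth_on I (\<kappa> \<sigma>)"
proof -
  have nz: "len_s s \<noteq> 0" "len_t s \<noteq> 0" "G s \<noteq> 0" if "s \<in> I" for s
    using len_pos[OF that] G_nz[OF that] by auto
  show ?thesis
    unfolding \<kappa>_def[abs_def] zc_def y1_def w1_def
    by (intro smooth_on_divide smooth_on_mult smooth_on_power smooth_on_add smooth_on_const
        open_I smooth_profile smooth_len smooth_G nz; assumption)
qed

end

section \<open>The criterion for a Gauss map of the second kind\<close>

context minimal_rotational_surface
begin

lemma has_laplacian_\<nu>\<^sub>0:
  assumes "p \<in> M1_domain I"
  shows "has_laplacian \<nu>\<^sub>0 p ((\<epsilon>s * \<epsilon>t / 2) *\<^sub>R (\<kappa> 1 (p$1) *\<^sub>R gpart 1 p + \<kappa> (-1) (p$1) *\<^sub>R gpart (-1) p))"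
  unfolding \<nu>\<^sub>0_def[abs_def]
  by (intro has_laplacian_scaleR has_laplacian_add has_laplacian_gpart assms) auto

text \<open>For \<open>b = 1\<close> and \<open>\<sigma> = 1\<close> the condition on \<open>zc\<close> holds automatically, which gives part (i).\<close>

lemma second_kindI:
  assumes \<sigma>: "\<sigma> = 1 \<or> \<sigma> = - 1" and z: "\<And>s. s \<in> I \<Longrightarrow> (1 - \<sigma> * b) * zc (\<sigma> * b) s = 0"
  shows "pointwise_1_type_second_kind r (M1_domain I)"
proof -
  define \<beta> where "\<beta> = \<sigma> * b"
  have \<beta>: "\<beta>\<^sup>2 = b\<^sup>2" using \<sigma> by (auto simp: \<beta>_def)
  have z: "(\<beta> - 1) * zc \<beta> s = 0" if "s \<in> I" for s
    using z[OF that] by (auto simp: \<beta>_def)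
  have d0: "(xc \<beta> has_real_derivative 0) (at s)" "(zc \<beta> has_real_derivative 0) (at s)" if "s \<in> I" for s
  proof -
    have "(\<beta> - 1) * \<epsilon>t * (len_s s / len_t s) * (zc \<beta> s)\<^sup>2 = 0"
      "(\<beta> - 1) * \<epsilon>t * (len_s s / len_t s) * (xc \<beta> s * zc \<beta> s) = 0"
      using z[OF that] by auto
    then show "(xc \<beta> has_real_derivative 0) (at s)" "(zc \<beta> has_real_derivative 0) (at s)"
      using DERIV_xc_zc[OF that \<beta>] by (simp_all only:)
  qed
  obtain x0 where x0: "\<And>s. s \<in> I \<Longrightarrow> xc \<beta> s = x0"
    using constant_on_interval[OF interval_I d0(1)] by blast
  obtain z0 where z0: "\<And>s. s \<in> I \<Longrightarrow> zc \<beta> s = z0"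
    using constant_on_interval[OF interval_I d0(2)] by blast
  \<comment> \<open>The value of the constant part. It has no \<open>gS\<close> term: either \<beta>
    = 1 and the sinh factor vanishes, or z0 = 0.\<close>
  define C0 where "C0 = x0 *\<^sub>R gJ \<sigma> + z0 *\<^sub>R gC \<sigma>"
  obtain s where s: "s \<in> I" using nonempty_I by auto
  have part: "gpart \<sigma> p = C0" if "p \<in> M1_domain I" for p
  proof -
    have p: "p$1 \<in> I" using that by (simp add: M1_domain_def)
    have "(\<beta> - 1) * z0 = 0" using z[OF s] z0[OF s] by simp
    then show ?thesis
      by (auto simp: gpart_def \<beta>_def[symmetric] x0[OF p] z0[OF p] C0_def)
  qed
  have C0: "C0 \<noteq> 0"
  proof
    assume "C0 = 0"
    then have "cJ \<sigma> C0 = 0" "cC \<sigma> C0 = 0" by (simp_all add: cJ_def cC_def)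
    then have "x0 = 0" "z0 = 0"
      using \<sigma> by (auto simp: C0_def coefficients_add coefficients_scaleR coefficients_basis)
    then show False
      using xc_zc_sq[OF s \<beta>] x0[OF s] z0[OF s] \<epsilon>_sq(3,4) by auto
  qed
  \<comment> \<open>Adding \<open>C\<close> removes the constant part from
    \<open>\<nu>\<^sub>0\<close>; the multiple of the other part that remains is an eigenfunction
    with factor \<open>\<kappa> (- \<sigma>)\<close>.\<close>
  define C where "C = - (\<epsilon>s * \<epsilon>t / 2) *\<^sub>R C0"
  have eqn: "laplacian r X \<nu>\<^sub>0 p = \<kappa> (- \<sigma>) (p$1) *\<^sub>R (\<nu>\<^sub>0 p + C)"
    if "U \<subseteq> M1_domain I" "tangent_frame r U X" "p \<in> U" for U X p
  proof -
    have p: "p \<in> M1_domain I" using that by blast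
    then have "p$1 \<in> I" by (simp add: M1_domain_def)
    then have "\<kappa> \<sigma> (p$1) = 0" using z by (auto simp: \<kappa>_def \<beta>_def)
    moreover have "laplacian r X \<nu>\<^sub>0 p = (\<epsilon>s * \<epsilon>t / 2) *\<^sub>R (\<kappa> 1 (p$1) *\<^sub>R gpart 1 p + \<kappa> (-1) (p$1) *\<^sub>R gpart (-1) p)"
      by (rule laplacian_eq[OF that(2,1,3) has_laplacian_\<nu>\<^sub>0[OF p]])
    ultimately show ?thesis
      using \<sigma> part[OF p] by (auto simp: \<nu>\<^sub>0_def C_def algebra_simps)
  qed
  have "smooth_on (M1_domain I) (\<lambda>p. \<kappa> (- \<sigma>) (p$1))"
    by (rule smooth_on_fst_component[OF open_I smooth_\<kappa>])
  then have "pointwise_1_type_with r (M1_domain I) C"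
    unfolding pointwise_1_type_with_def using is_gauss_map_\<nu>\<^sub>0 eqn by blast
  moreover have "C \<in> bivectors"
    unfolding C_def C0_def by (intro bivectors_scaleR bivectors_add gJ_gC_in_bivectors)
  moreover have "C \<noteq> 0" using C0 \<epsilon>_sq(3,4) by (auto simp: C_def)
  ultimately show ?thesis unfolding pointwise_1_type_second_kind_def by blast
qed

lemma second_kindD:
  assumes b: "b > 0" "b \<noteq> 1" and "pointwise_1_type_second_kind r (M1_domain I)"
  obtains \<sigma> where "\<sigma> = 1 \<or> \<sigma> = - 1" "\<And>s. s \<in> I \<Longrightarrow> zc (\<sigma> * b) s = 0"
proof -
  obtain C where C: "C \<in> bivectors" "C \<noteq> 0" and "pointwise_1_type_with r (M1_domain I) C"
    using assms(3) unfolding pointwise_1_type_second_kind_def by blast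
  then obtain \<nu> and f :: "real^2 \<Rightarrow> real" where \<nu>: "is_gauss_map r (M1_domain I) \<nu>"
    and eqn: "\<forall>U X. U \<subseteq> M1_domain I \<and> tangent_frame r U X \<longrightarrow>
      (\<forall>p\<in>U. laplacian r X \<nu> p = f p *\<^sub>R (\<nu> p + C))"
    unfolding pointwise_1_type_with_def by auto
  obtain \<sigma> where \<sigma>: "\<sigma> = 1 \<or> \<sigma> = - 1" and c: "cJ \<sigma> C \<noteq> 0 \<or> cC \<sigma> C \<noteq> 0 \<or> cS \<sigma> C \<noteq> 0"
    using bivector_coefficients_nonzero[OF C] by blast
  define \<beta> where "\<beta> = \<sigma> * b"
  have \<beta>1: "1 - \<beta> \<noteq> 0" using \<sigma> b by (auto simp: \<beta>_def)
  \<comment> \<open>The \<sigma>-components of \<Delta>\<nu> = f (\<nu> + C). The factor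
    \<open>h\<close> contains the local sign of \<nu> and may depend on p, hence the existential
    quantifier.\<close>
  have rel: "\<exists>h. h \<noteq> 0 \<and> (\<kappa> \<sigma> (p$1) - f p) * h * xc \<beta> (p$1) = f p * cJ \<sigma> C \<and>
      (\<kappa> \<sigma> (p$1) - f p) * h * (zc \<beta> (p$1) * cosh ((1 - \<beta>) * p$2)) = f p * cC \<sigma> C \<and>
      (\<kappa> \<sigma> (p$1) - f p) * h * (zc \<beta> (p$1) * sinh ((1 - \<beta>) * p$2)) = f p * cS \<sigma> C"
    if p: "p \<in> M1_domain I" for p
  proof -
    obtain k V where k: "k = 1 \<or> k = - 1" and V: "open V" "p \<in> V"
      and \<nu>k: "\<And>q. q \<in> V \<Longrightarrow> \<nu> q = k *\<^sub>R \<nu>\<^sub>0 q"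
      using gauss_map_pm[OF \<nu> p] by metis
    define h where "h = k * (\<epsilon>s * \<epsilon>t / 2)"
    have h: "h \<noteq> 0" using k \<epsilon>_sq(3,4) by (auto simp: h_def)
    have "has_laplacian \<nu> p (k *\<^sub>R ((\<epsilon>s * \<epsilon>t / 2) *\<^sub>R (\<kappa> 1 (p$1) *\<^sub>R gpart 1 p + \<kappa> (-1) (p$1) *\<^sub>R gpart (-1) p)))"
      using \<nu>k by (intro has_laplacian_cong[OF has_laplacian_scaleR[OF has_laplacian_\<nu>\<^sub>0[OF p]] V]) auto
    from laplacian_eq[OF tangent_unit_frame order_refl p this]
    have "f p *\<^sub>R (\<nu> p + C) = h *\<^sub>R (\<kappa> 1 (p$1) *\<^sub>R gpart 1 p + \<kappa> (-1) (p$1) *\<^sub>R gpart (-1) p)"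
      using eqn[rule_format, OF conjI[OF order_refl tangent_unit_frame] p] by (simp add: h_def)
    then have main: "h *\<^sub>R (\<kappa> 1 (p$1) *\<^sub>R gpart 1 p + \<kappa> (-1) (p$1) *\<^sub>R gpart (-1) p)
        = f p *\<^sub>R (h *\<^sub>R (1 *\<^sub>R gpart 1 p + 1 *\<^sub>R gpart (-1) p) + C)"
      unfolding \<nu>k[OF V(2)] \<nu>\<^sub>0_def h_def by simp
    note co = coefficients_scaleR coefficients_add(1)[of _ "h *\<^sub>R _"] coefficients_add(2)[of _ "h *\<^sub>R _"]
      coefficients_add(3)[of _ "h *\<^sub>R _"] \<nu>\<^sub>0_coefficients[OF \<sigma>]
    have "cJ \<sigma> (h *\<^sub>R (\<kappa> 1 (p$1) *\<^sub>R gpart 1 p + \<kappa> (-1) (p$1) *\<^sub>R gpart (-1) p))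
        = cJ \<sigma> (f p *\<^sub>R (h *\<^sub>R (1 *\<^sub>R gpart 1 p + 1 *\<^sub>R gpart (-1) p) + C))"
      "cC \<sigma> (h *\<^sub>R (\<kappa> 1 (p$1) *\<^sub>R gpart 1 p + \<kappa> (-1) (p$1) *\<^sub>R gpart (-1) p))
        = cC \<sigma> (f p *\<^sub>R (h *\<^sub>R (1 *\<^sub>R gpart 1 p + 1 *\<^sub>R gpart (-1) p) + C))"
      "cS \<sigma> (h *\<^sub>R (\<kappa> 1 (p$1) *\<^sub>R gpart 1 p + \<kappa> (-1) (p$1) *\<^sub>R gpart (-1) p))
        = cS \<sigma> (f p *\<^sub>R (h *\<^sub>R (1 *\<^sub>R gpart 1 p + 1 *\<^sub>R gpart (-1) p) + C))"
      using main by simp_all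
    then have "(\<kappa> \<sigma> (p$1) - f p) * (2 * h) * xc \<beta> (p$1) = f p * cJ \<sigma> C"
      "(\<kappa> \<sigma> (p$1) - f p) * (2 * h) * (zc \<beta> (p$1) * cosh ((1 - \<beta>) * p$2)) = f p * cC \<sigma> C"
      "(\<kappa> \<sigma> (p$1) - f p) * (2 * h) * (zc \<beta> (p$1) * sinh ((1 - \<beta>) * p$2)) = f p * cS \<sigma> C"
      unfolding co using \<sigma> by (auto simp: \<beta>_def algebra_simps)
    then show ?thesis using h by (intro exI[of _ "2 * h"]) auto
  qed
  have "zc \<beta> s = 0" if s: "s \<in> I" for s
  proof (rule ccontr)
    assume z: "zc \<beta> s \<noteq> 0"
    have \<kappa>: "\<kappa> \<sigma> s \<noteq> 0"
      using z \<beta>1 G_nz[OF s] \<epsilon>_sq(3,4) by (auto simp: \<kappa>_def \<beta>_def)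
    \<comment> \<open>f p = 0 contradicts the cosh equation, as \<kappa>, h and z are nonzero there;
      given this, \<kappa> = f p would make all three coefficients of C vanish.\<close>
    have *: "f p \<noteq> 0 \<and> \<kappa> \<sigma> s - f p \<noteq> 0" if ps: "p$1 = s" for p :: "real^2"
    proof -
      have p: "p \<in> M1_domain I" using s ps by (simp add: M1_domain_def)
      obtain h where "h \<noteq> 0 \<and> (\<kappa> \<sigma> s - f p) * h * xc \<beta> s = f p * cJ \<sigma> C \<and>
        (\<kappa> \<sigma> s - f p) * h * (zc \<beta> s * cosh ((1 - \<beta>) * p$2)) = f p * cC \<sigma> C \<and>
        (\<kappa> \<sigma> s - f p) * h * (zc \<beta> s * sinh ((1 - \<beta>) * p$2)) = f p * cS \<sigma> C"
        using rel[OF p] unfolding ps ..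
      then have h: "h \<noteq> 0" "(\<kappa> \<sigma> s - f p) * h * xc \<beta> s = f p * cJ \<sigma> C"
        "(\<kappa> \<sigma> s - f p) * h * (zc \<beta> s * cosh ((1 - \<beta>) * p$2)) = f p * cC \<sigma> C"
        "(\<kappa> \<sigma> s - f p) * h * (zc \<beta> s * sinh ((1 - \<beta>) * p$2)) = f p * cS \<sigma> C"
        by simp_all
      have "f p \<noteq> 0" using h(1,3) z \<kappa> by (auto simp: cosh_real_nonzero)
      moreover from this have "\<kappa> \<sigma> s - f p \<noteq> 0" using h c by auto
      ultimately show ?thesis by blast
    qed
    \<comment> \<open>Two points with the same s suffice: at t = 0 the sinh equation kills the
      coefficient \<open>cS \<sigma> C\<close>, and at t = 1 this contradicts sinh (1 - \<beta>)
      \<noteq> 0.\<close>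
    define p0 p1 :: "real^2" where "p0 = vector [s, 0]" and "p1 = vector [s, 1]"
    have p01: "p0$1 = s" "p0$2 = 0" "p1$1 = s" "p1$2 = 1" by (simp_all add: p0_def p1_def)
    then have "p0 \<in> M1_domain I" "p1 \<in> M1_domain I" using s by (simp_all add: M1_domain_def)
    from rel[OF this(1)] have "f p0 * cS \<sigma> C = 0" by (auto simp: p01)
    then have cS: "cS \<sigma> C = 0" using *[OF p01(1)] by simp
    obtain h where "h \<noteq> 0" "(\<kappa> \<sigma> s - f p1) * h * (zc \<beta> s * sinh (1 - \<beta>)) = f p1 * cS \<sigma> C"
      using rel[OF \<open>p1 \<in> M1_domain I\<close>] by (auto simp: p01)
    then show False using *[OF p01(3)] cS z \<beta>1 by simp
  qed
  then show ?thesis using that \<sigma> by (simp add: \<beta>_def)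
qed

lemma zc_eq_0_iff:
  assumes "s \<in> I"
  shows "zc \<beta> s = 0 \<longleftrightarrow> w s * deriv y s + \<beta> * y s * deriv w s = 0"
proof -
  have "zc \<beta> s = (w s * deriv y s + \<beta> * y s * deriv w s) / (len_s s * len_t s)"
    using len_pos[OF assms] by (simp add: zc_def y1_def w1_def field_simps)
  then show ?thesis using len_pos[OF assms] by simp
qed

end

section \<open>The profile curve\<close>

text \<open>Hyperbolic polar coordinates: the image is the set of points in one wedge of the (i, j)
  plane whose signed radius lies in f(I), and f(I) is open because f is continuous and injective.
  This recognises as planar the surfaces whose profile curve lies on a coordinate axis.\<close>

lemma open_part_of_plane_cone:
  fixes f :: "real \<Rightarrow> real" and c :: real and i j :: 4
  assumes I: "open I" "is_interval I" "I \<noteq> {}" and ij: "i \<noteq> j" and c: "c \<noteq> 0"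
    and f: "\<And>s. s \<in> I \<Longrightarrow> (f has_real_derivative f' s) (at s)"
    and f': "\<And>s. s \<in> I \<Longrightarrow> f' s \<noteq> 0" and nz: "\<And>s. s \<in> I \<Longrightarrow> f s \<noteq> 0"
  shows "open_part_of_plane ((\<lambda>p::real^2. (f (p$1) * cosh (c * p$2)) *\<^sub>R axis i 1
    + (f (p$1) * sinh (c * p$2)) *\<^sub>R axis j 1) ` M1_domain I)"
    (is "open_part_of_plane (?F ` _)")
proof -
  have cont: "continuous_on I f"
    using f DERIV_isCont by (blast intro: continuous_at_imp_continuous_on)
  have "inj_on f I"
  proof (rule linorder_inj_onI')
    fix s t assume st: "s \<in> I" "t \<in> I" "s < t"
    have sub: "u \<in> I" if "s \<le> u" "u \<le> t" for u
      using mem_is_interval_1_I[OF I(2) st(1,2) that] .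
    obtain u where "s < u" "u < t" "f t - f s = (t - s) * f' u"
      using MVT2[OF st(3), of f f'] f sub by blast
    then show "f s \<noteq> f t" using f'[OF sub, of u] st(3) by auto
  qed
  then have oJ: "open (f ` I)" by (rule invariance_of_domain[OF cont I(1)])
  obtain s0 where s0: "s0 \<in> I" using I(3) by auto
  define \<epsilon> where "\<epsilon> = sgn (f s0)"
  have \<epsilon>: "\<epsilon> = 1 \<or> \<epsilon> = - 1" using nz[OF s0] by (auto simp: \<epsilon>_def sgn_if)
  have pos: "\<epsilon> * f s > 0" if "s \<in> I" for s
    using sgn_constant_on_interval[OF I(2) cont nz s0 that] nz[OF that]
    by (auto simp: \<epsilon>_def sgn_if split: if_splits)
  define P :: "(real^4) set" where "P = {x. \<forall>k. k \<notin> {i, j} \<longrightarrow> x$k = 0}"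
  have sub: "subspace P" by (auto simp: P_def subspace_def)
  have "dim P = 2"
    using dim_substandard_cart[of "{i, j}", where 'a = real] ij by (simp add: P_def dim_vec_eq)
  then have P: "affine P" "aff_dim P = 2"
    using sub by (simp_all add: subspace_imp_affine aff_dim_subspace)
  \<comment> \<open>Signed radius. HOL's \<open>sqrt\<close> is odd, so g is continuous everywhere;
    where |x_j| \<ge> |x_i| it vanishes or has the wrong sign, which keeps such points out of
    \<open>T\<close>.\<close>
  define g where "g x = \<epsilon> * sqrt ((x$i)\<^sup>2 - (x$j)\<^sup>2)" for x :: "real^4"
  define T where "T = {x. 0 < \<epsilon> * x$i} \<inter> g -` (f ` I)"
  have "continuous_on UNIV g" unfolding g_def[abs_def] by (intro continuous_intros)
  then have "open T"
    unfolding T_def using oJ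
    by (intro open_Int open_Collect_less continuous_intros)
      (metis continuous_on_open_vimage open_UNIV Int_UNIV_right)
  have "?F ` M1_domain I = P \<inter> T"
  proof (intro equalityI subsetI)
    fix x assume "x \<in> ?F ` M1_domain I"
    then obtain p where p: "p \<in> M1_domain I" and x: "x = ?F p" by blast
    have s: "p$1 \<in> I" using p by (simp add: M1_domain_def)
    have xi: "x$i = f (p$1) * cosh (c * p$2)" and xj: "x$j = f (p$1) * sinh (c * p$2)"
      and "x \<in> P"
      using ij by (auto simp: x P_def axis_def)
    have "0 < \<epsilon> * x$i"
      unfolding xi using mult_pos_pos[OF pos[OF s] cosh_real_pos[of "c * p$2"]] by (simp add: mult.assoc)
    moreover have "(x$i)\<^sup>2 - (x$j)\<^sup>2 = (f (p$1))\<^sup>2"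
      unfolding xi xj using cosh_square_eq[of "c * p$2"] by (simp add: power_mult_distrib algebra_simps)
    then have "g x = f (p$1)"
      using pos[OF s] \<epsilon> by (auto simp: g_def)
    ultimately show "x \<in> P \<inter> T" using \<open>x \<in> P\<close> s by (auto simp: T_def)
  next
    fix x assume "x \<in> P \<inter> T"
    then obtain s where xP: "x \<in> P" and xi: "0 < \<epsilon> * x$i" and s: "s \<in> I" and gx: "g x = f s"
      by (auto simp: T_def)
    have "0 < \<epsilon> * (\<epsilon> * sqrt ((x$i)\<^sup>2 - (x$j)\<^sup>2))"
      using pos[OF s] gx by (simp add: g_def)
    then have D: "(x$i)\<^sup>2 - (x$j)\<^sup>2 > 0" using \<epsilon> by auto
    have fs2: "(f s)\<^sup>2 = (x$i)\<^sup>2 - (x$j)\<^sup>2"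
      using D \<epsilon> by (auto simp: gx[symmetric] g_def)
    \<comment> \<open>t is solved from the sinh component; the cosh component then follows from its
      square and its sign.\<close>
    define t where "t = arsinh (x$j / f s) / c"
    have sh: "f s * sinh (c * t) = x$j"
      using c nz[OF s] by (simp add: t_def)
    have "(f s * cosh (c * t))\<^sup>2 = (x$i)\<^sup>2"
      using cosh_square_eq[of "c * t"] fs2 by (simp add: power_mult_distrib algebra_simps flip: sh)
    moreover have "0 < \<epsilon> * (f s * cosh (c * t))"
      using mult_pos_pos[OF pos[OF s] cosh_real_pos[of "c * t"]] by (simp add: mult.assoc)
    ultimately have ch: "f s * cosh (c * t) = x$i"
      using xi \<epsilon> by (auto simp: power2_eq_iff)
    have "x = ?F (vector [s, t])"
      using xP ij by (auto simp: vec_eq_iff P_def axis_def sh ch)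
    moreover have "vector [s, t] \<in> M1_domain I" using s by (simp add: M1_domain_def)
    ultimately show "x \<in> ?F ` M1_domain I" by blast
  qed
  then have "openin (top_of_set P) (?F ` M1_domain I)"
    using \<open>open T\<close> by (metis openin_open)
  then show ?thesis unfolding open_part_of_plane_def using P by blast
qed

text \<open>ln (x^2) is differentiable on both sides of 0, which spares a case split on the sign of
  x.\<close>

lemma abs_powr_eq_exp: "x \<noteq> 0 \<Longrightarrow> \<bar>x\<bar> powr a = exp (a / 2 * ln (x\<^sup>2))" for x a :: real
  using ln_realpow[of "\<bar>x\<bar>" 2] by (simp add: powr_def)

lemma DERIV_abs_powr:
  fixes g :: "real \<Rightarrow> real"
  assumes "(g has_real_derivative g') (at s)" "g s \<noteq> 0"
  shows "((\<lambda>s. exp (a / 2 * ln ((g s)\<^sup>2))) has_real_derivative \<bar>g s\<bar> powr a * (a * g' / g s)) (at s)"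
proof -
  have "0 < g s * g s" using assms(2) not_real_square_gt_zero by blast
  then show ?thesis
    using assms by (auto intro!: derivative_eq_intros simp: abs_powr_eq_exp power2_eq_square)
qed

text \<open>Integrating factor: the derivative of the product is |g|^a / g times the left side of
  \<open>ode\<close>.\<close>

lemma mult_abs_powr_constant:
  fixes f g f' g' :: "real \<Rightarrow> real"
  assumes I: "is_interval I" and nz: "\<And>s. s \<in> I \<Longrightarrow> g s \<noteq> 0"
    and f: "\<And>s. s \<in> I \<Longrightarrow> (f has_real_derivative f' s) (at s)"
    and g: "\<And>s. s \<in> I \<Longrightarrow> (g has_real_derivative g' s) (at s)"
    and ode: "\<And>s. s \<in> I \<Longrightarrow> g s * f' s + a * f s * g' s = 0"
  shows "\<exists>c. \<forall>s\<in>I. f s * \<bar>g s\<bar> powr a = c"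
proof -
  have "\<exists>c. \<forall>s\<in>I. f s * exp (a / 2 * ln ((g s)\<^sup>2)) = c"
  proof (rule constant_on_interval[OF I])
    fix s assume s: "s \<in> I"
    have "f s * (\<bar>g s\<bar> powr a * (a * g' s / g s)) + f' s * \<bar>g s\<bar> powr a
        = \<bar>g s\<bar> powr a / g s * (g s * f' s + a * f s * g' s)"
      using nz[OF s] by (simp add: field_simps)
    then show "((\<lambda>s. f s * exp (a / 2 * ln ((g s)\<^sup>2))) has_real_derivative 0) (at s)"
      using DERIV_mult[OF f[OF s] DERIV_abs_powr[OF g[OF s] nz[OF s], of a]] ode[OF s]
      by (simp add: abs_powr_eq_exp[OF nz[OF s]] add.commute mult.commute)
  qed
  then show ?thesis using nz by (simp add: abs_powr_eq_exp)
qed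

section \<open>Planar profile curves and power laws\<close>

context rotational_surface
begin

lemma planar_if_w_zero:
  assumes b: "b \<noteq> 0" and w: "\<And>s. s \<in> I \<Longrightarrow> w s = 0" "\<And>s. s \<in> I \<Longrightarrow> deriv w s = 0"
  shows "open_part_of_plane (r ` M1_domain I)"
proof -
  have "deriv y s \<noteq> 0" "y s \<noteq> 0" if "s \<in> I" for s
    using E_nz[OF that] G_nz[OF that] w[OF that] by (auto simp: E_def G_def)
  then have "open_part_of_plane ((\<lambda>p::real^2. (y (p$1) * cosh (b * p$2)) *\<^sub>R axis 2 1
    + (y (p$1) * sinh (b * p$2)) *\<^sub>R axis 3 1) ` M1_domain I)"
    using b by (intro open_part_of_plane_cone[OF open_I interval_I nonempty_I _ _ DERIV_profile(1)]) auto
  also have "(\<lambda>p::real^2. (y (p$1) * cosh (b * p$2)) *\<^sub>R axis 2 1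
    + (y (p$1) * sinh (b * p$2)) *\<^sub>R axis 3 1) ` M1_domain I = r ` M1_domain I"
    by (rule image_cong) (auto simp: M1_separated M1_domain_def w)
  finally show ?thesis .
qed

lemma planar_if_y_zero:
  assumes y: "\<And>s. s \<in> I \<Longrightarrow> y s = 0" "\<And>s. s \<in> I \<Longrightarrow> deriv y s = 0"
  shows "open_part_of_plane (r ` M1_domain I)"
proof -
  have "deriv w s \<noteq> 0" "w s \<noteq> 0" if "s \<in> I" for s
    using E_nz[OF that] G_nz[OF that] y[OF that] by (auto simp: E_def G_def)
  then have "open_part_of_plane ((\<lambda>p::real^2. (w (p$1) * cosh (1 * p$2)) *\<^sub>R axis 4 1
    + (w (p$1) * sinh (1 * p$2)) *\<^sub>R axis 1 1) ` M1_domain I)"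
    by (intro open_part_of_plane_cone[OF open_I interval_I nonempty_I _ _ DERIV_profile(2)]) auto
  also have "(\<lambda>p::real^2. (w (p$1) * cosh (1 * p$2)) *\<^sub>R axis 4 1
    + (w (p$1) * sinh (1 * p$2)) *\<^sub>R axis 1 1) ` M1_domain I = r ` M1_domain I"
    by (rule image_cong) (auto simp: M1_separated M1_domain_def y add.commute)
  finally show ?thesis .
qed

text \<open>Integration needs w to be nonzero throughout. The zeros of w form a clopen subset of the
  interval: near a zero y is nonzero by regularity, and the equation with y and w exchanged forces w
  = 0 nearby. One zero would thus make w vanish identically and the surface planar.\<close>

lemma profile_powr:
  assumes nonplanar: "\<not> open_part_of_plane (r ` M1_domain I)" and b: "b \<noteq> 0" and \<beta>: "\<beta> \<noteq> 0"
    and ode: "\<And>s. s \<in> I \<Longrightarrow> w s * deriv y s + \<beta> * y s * deriv w s = 0"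
  shows "\<exists>c. c \<noteq> 0 \<and> (\<forall>s\<in>I. y s = c * \<bar>w s\<bar> powr (- \<beta>))"
proof -
  have yw: "y s \<noteq> 0 \<or> w s \<noteq> 0" if "s \<in> I" for s
    using G_nz[OF that] by (auto simp: G_def)
  define Z where "Z = {s \<in> I. w s = 0}"
  have "closedin (top_of_set I) Z"
    unfolding Z_def by (intro continuous_closedin_preimage_constant smooth_on_imp_continuous_on smooth_w)
  moreover have "open Z"
    unfolding open_contains_ball
  proof
    fix s assume sZ: "s \<in> Z"
    then have "s \<in> I \<inter> y -` (- {0})" using yw by (auto simp: Z_def)
    moreover have "open (I \<inter> y -` (- {0}))"
      by (intro continuous_open_preimage smooth_on_imp_continuous_on smooth_y open_I) auto
    ultimately obtain e where e: "e > 0" "ball s e \<subseteq> I \<inter> y -` (- {0})"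
      unfolding open_contains_ball by blast
    \<comment> \<open>Roles exchanged: dividing the equation by \<beta> gives the exponent 1 /
      \<beta>, and the constant turns out to be 0 because w s = 0.\<close>
    have "\<exists>c. \<forall>u\<in>ball s e. w u * \<bar>y u\<bar> powr (1 / \<beta>) = c"
    proof (rule mult_abs_powr_constant[where f' = "deriv w" and g' = "deriv y"])
      show "is_interval (ball s e)" by (simp add: is_interval_ball_real)
      fix u assume u: "u \<in> ball s e"
      then have uI: "u \<in> I" using e(2) by blast
      show "y u \<noteq> 0" using u e(2) by blast
      show "(w has_real_derivative deriv w u) (at u)" "(y has_real_derivative deriv y u) (at u)"
        using DERIV_profile(1,2)[OF uI] by auto
      have "y u * deriv w u + 1 / \<beta> * w u * deriv y u = (w u * deriv y u + \<beta> * y u * deriv w u) / \<beta>"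
        using \<beta> by (simp add: field_simps)
      then show "y u * deriv w u + 1 / \<beta> * w u * deriv y u = 0" using ode[OF uI] by simp
    qed
    then obtain c where c: "\<And>u. u \<in> ball s e \<Longrightarrow> w u * \<bar>y u\<bar> powr (1 / \<beta>) = c" by blast
    have "c = 0" using c[of s] e(1) sZ by (simp add: Z_def)
    have "w u = 0" if "u \<in> ball s e" for u
      using c[OF that] \<open>c = 0\<close> e(2) that by auto
    then show "\<exists>e>0. ball s e \<subseteq> Z" using e by (auto simp: Z_def)
  qed
  then have "openin (top_of_set I) Z"
    by (intro open_openin_trans open_I) (auto simp: Z_def)
  ultimately have "Z = {} \<or> Z = I"
    using interval_I by (simp add: is_interval_connected_1 connected_clopen)
  moreover have "Z \<noteq> I"
  proof
    assume "Z = I"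
    then have w: "w s = 0" if "s \<in> I" for s using that by (auto simp: Z_def)
    moreover have "deriv w s = 0" if "s \<in> I" for s
      using ode[OF that] w[OF that] yw[OF that] \<beta> by simp
    ultimately show False using planar_if_w_zero[OF b] nonplanar by blast
  qed
  ultimately have w_nz: "w s \<noteq> 0" if "s \<in> I" for s using that by (auto simp: Z_def)
  obtain c where c: "\<And>s. s \<in> I \<Longrightarrow> y s * \<bar>w s\<bar> powr \<beta> = c"
    using mult_abs_powr_constant[OF interval_I w_nz DERIV_profile(1,2) ode] by blast
  then have y: "y s = c * \<bar>w s\<bar> powr (- \<beta>)" if "s \<in> I" for s
    using c[OF that] w_nz[OF that] by (simp add: powr_minus field_simps)
  \<comment> \<open>c = 0 would make y vanish identically, the other planar case.\<close>
  have "c \<noteq> 0"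
  proof
    assume "c = 0"
    then have y0: "y s = 0" if "s \<in> I" for s using y[OF that] by simp
    moreover have "deriv y s = 0" if "s \<in> I" for s
      using ode[OF that] y0[OF that] w_nz[OF that] by simp
    ultimately show False using planar_if_y_zero nonplanar by blast
  qed
  then show ?thesis using y by blast
qed

lemma profile_powr_ode:
  assumes y: "\<And>s. s \<in> I \<Longrightarrow> y s = c * \<bar>w s\<bar> powr a" and s: "s \<in> I"
  shows "w s * deriv y s - a * y s * deriv w s = 0"
proof -
  \<comment> \<open>At a zero of w the convention \<open>0 powr a = 0\<close> gives y = 0 as well,
    contradicting \<open>G_nz\<close>.\<close>
  have w: "w u \<noteq> 0" if "u \<in> I" for u
    using y[OF that] G_nz[OF that] by (auto simp: G_def)
  have "((\<lambda>u. c * exp (a / 2 * ln ((w u)\<^sup>2))) has_real_derivative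
      c * (\<bar>w s\<bar> powr a * (a * deriv w s / w s))) (at s)"
    by (intro DERIV_cmult DERIV_abs_powr DERIV_profile w s)
  then have "(y has_real_derivative c * (\<bar>w s\<bar> powr a * (a * deriv w s / w s))) (at s)"
    by (rule has_field_derivative_transform_within_open[OF _ open_I s])
      (simp add: y w abs_powr_eq_exp)
  then have "deriv y s = c * (\<bar>w s\<bar> powr a * (a * deriv w s / w s))"
    by (rule DERIV_imp_deriv)
  then show ?thesis using w[OF s] by (simp add: y[OF s])
qed

end

theorem theorem4p1:
  fixes b :: real and I :: "real set" and y w :: "real \<Rightarrow> real"
  assumes b: "b > 0"
    and I: "open I" "is_interval I" "I \<noteq> {}"
    and smooth: "smooth_on I y" "smooth_on I w"
    and regular: "M1_regular b I y w"
    and nonplanar: "\<not> open_part_of_plane (M1 b y w ` M1_domain I)"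
    and zero_mean: "zero_mean_curvature (M1 b y w) (M1_domain I)"
  shows "(b = 1 \<and> (\<exists>l\<^sub>0 m\<^sub>0. l\<^sub>0 \<noteq> 0 \<and>
              (\<forall>s\<in>I. (w s + y s)\<^sup>2 + l\<^sub>0 * (w s - y s)\<^sup>2 = m\<^sub>0)) \<longrightarrow>
            pointwise_1_type_second_kind (M1 b y w) (M1_domain I)) \<and>
         (b \<noteq> 1 \<and> M1_timelike b I y w \<longrightarrow>
            (pointwise_1_type_second_kind (M1 b y w) (M1_domain I) \<longleftrightarrow>
             (\<exists>b\<^sub>0. b\<^sub>0 \<noteq> 0 \<and>
                ((\<forall>s\<in>I. y s = b\<^sub>0 * \<bar>w s\<bar> powr b) \<or>
                 (\<forall>s\<in>I. y s = b\<^sub>0 * \<bar>w s\<bar> powr (- b))))))"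
proof -
  interpret minimal_rotational_surface b I y w
    using assms by unfold_locales
  have "pointwise_1_type_second_kind (M1 b y w) (M1_domain I)" if "b = 1"
    by (rule second_kindI[of 1]) (simp_all add: that)
  moreover have "\<exists>b\<^sub>0. b\<^sub>0 \<noteq> 0 \<and> ((\<forall>s\<in>I. y s = b\<^sub>0 * \<bar>w s\<bar> powr b) \<or> (\<forall>s\<in>I. y s = b\<^sub>0 * \<bar>w s\<bar> powr (- b)))"
    if b1: "b \<noteq> 1" and sk: "pointwise_1_type_second_kind (M1 b y w) (M1_domain I)"
  proof -
    obtain \<sigma> where \<sigma>: "\<sigma> = 1 \<or> \<sigma> = - 1" and z: "\<And>s. s \<in> I \<Longrightarrow> zc (\<sigma> * b) s = 0"
      using second_kindD[OF b b1 sk] by blast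
    have "\<exists>c. c \<noteq> 0 \<and> (\<forall>s\<in>I. y s = c * \<bar>w s\<bar> powr (- (\<sigma> * b)))"
      using b \<sigma> z by (intro profile_powr[OF nonplanar]) (auto simp: zc_eq_0_iff)
    then show ?thesis using \<sigma> by auto
  qed
  moreover have "pointwise_1_type_second_kind (M1 b y w) (M1_domain I)"
    if y: "(\<forall>s\<in>I. y s = b\<^sub>0 * \<bar>w s\<bar> powr b) \<or> (\<forall>s\<in>I. y s = b\<^sub>0 * \<bar>w s\<bar> powr (- b))" for b\<^sub>0
  proof -
    \<comment> \<open>The exponent b belongs to \<sigma> = -1, the exponent -b to \<sigma> =
      1.\<close>
    obtain \<sigma> :: real where \<sigma>: "\<sigma> = 1 \<or> \<sigma> = - 1" and y: "\<And>s. s \<in> I \<Longrightarrow> y s = b\<^sub>0 * \<bar>w s\<bar> powr (- (\<sigma> * b))"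
      using y by (elim disjE) (metis minus_minus mult_minus1, metis mult_1)
    show ?thesis
      by (rule second_kindI[OF \<sigma>]) (use profile_powr_ode[OF y] in \<open>simp add: zc_eq_0_iff\<close>)
  qed
  ultimately show ?thesis by blast
qed

end
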